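(* Let $(h,W)$ be navigation data on $M$, let $\mathcal F$ be the associated Randers-type norm, and for a curve $c$ from $p$ to $q$ let $\mathcal P=\mathcal P_c$ be the natural parallel translation along $c$ associated to $(h,W)$. Then: (1) $\mathcal P$ is homogeneous: $\mathcal P(tV_p)=t\,\mathcal P(V_p)$ for every nonzero $V_p\in T_pM$ and every $t>0$; (2) $\mathcal P$ preserves $\mathcal F$: $\mathcal F(\mathcal P(V_p))=\mathcal F(V_p)$ for every nonzero $V_p\in T_pM$; (3) $\mathcal P$ is in general nonlinear: there exist navigation data and a curve $c$ for which $\mathcal P$ is not additive, i.e. $\mathcal P(U_p+V_p)\neq \mathcal P(U_p)+\mathcal P(V_p)$ for some $U_p,V_p\in T_pM$ with $U_p$, $V_p$ and $U_p+V_p$ nonzero.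
   Context: $M$ is a connected $C^\infty$ manifold. Navigation data on $M$ is a pair $(h,W)$, where $h$ is a Riemannian metric and $W$ is a smooth vector field with $|W|^2<1$ everywhere; here $\langle X,Y\rangle=h_x(X,Y)$ and $|X|^2=h_x(X,X)$. The associated Randers-type Finsler norm is $$\mathcal F(x,y)=\frac{\sqrt{\langle y,W\rangle^2+\lambda|y|^2}}{\lambda}-\frac{\langle y,W\rangle}{\lambda},\qquad \lambda=1-|W|^2,\quad x\in M,\ y\in T_xM .$$ For a curve $c$ in $M$ from $p$ to $q$, let $\mathcal P_R:T_pM\to T_qM$ be the Riemannian (Levi-Civita) parallel translation of $h$ along $c$. The natural parallel translation $\mathcal P$ along $c$ associated to $(h,W)$ is defined, for $V^\circ_p\in T_pM$ with $\mathcal F(V^\circ_p)=1$, by $\mathcal P(V^\circ_p)=\mathcal P_R(V^\circ_p-W_p)+W_q$, and for arbitrary nonzero $V_p\in T_pM$ by $\mathcal P(V_p)=\mathcal F(V_p)\,\mathcal P\bigl(\tfrac{1}{\mathcal F(V_p)}V_p\bigr)$. *)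

theory Defs
  imports "HOL-Analysis.Analysis" "HOL-Library.Function_Algebras"
begin

(* Pointwise vector space structure on function spaces; addition and zero come from
   Function_Algebras.  It provides the linear structure of the tangent spaces below. *)

instantiation "fun" :: (type, real_vector) real_vector
begin

definition scaleR_fun :: "real \<Rightarrow> ('a \<Rightarrow> 'b) \<Rightarrow> 'a \<Rightarrow> 'b" where
  "scaleR_fun r f = (\<lambda>x. r *\<^sub>R f x)"

instance
  by standard (simp_all add: scaleR_fun_def plus_fun_def fun_eq_iff algebra_simps)

end

(* Ck_on k S f and smooth_on S f are meant for open S only; on an open set C^k means that all
   iterated directional derivatives up to order k exist and are continuous. *)

primrec Ck_on ::
  "nat \<Rightarrow> 'x::euclidean_space set \<Rightarrow> ('x \<Rightarrow> 'y::real_normed_vector) \<Rightarrow> bool" where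
  "Ck_on 0 S f \<longleftrightarrow> continuous_on S f"
| "Ck_on (Suc k) S f \<longleftrightarrow>
     f differentiable_on S \<and> (\<forall>v. Ck_on k S (\<lambda>x. frechet_derivative f (at x) v))"

definition smooth_on ::
  "'x::euclidean_space set \<Rightarrow> ('x \<Rightarrow> 'y::real_normed_vector) \<Rightarrow> bool" where
  "smooth_on S f \<longleftrightarrow> (\<forall>k. Ck_on k S f)"


section \<open>Manifolds and tangent spaces\<close>

text \<open>
  The manifold is the whole point type, with its Hausdorff, second countable topology; the smooth
  structure is given by an atlas, not necessarily maximal.  A chart is a pair of its domain and
  its coordinate map; values of the coordinate map off the domain are irrelevant.
\<close>

type_synonym ('a, 'e) chart = "'a set \<times> ('a \<Rightarrow> 'e)"

abbreviation chart_inv :: "('a, 'e) chart \<Rightarrow> 'e \<Rightarrow> 'a" where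
  "chart_inv \<kappa> \<equiv> inv_into (fst \<kappa>) (snd \<kappa>)"

abbreviation chart_image :: "('a, 'e) chart \<Rightarrow> 'e set" where
  "chart_image \<kappa> \<equiv> snd \<kappa> ` fst \<kappa>"

definition is_chart :: "('a::topological_space, 'e::euclidean_space) chart \<Rightarrow> bool" where
  "is_chart \<kappa> \<longleftrightarrow> open (fst \<kappa>) \<and> open (chart_image \<kappa>) \<and>
     homeomorphism (fst \<kappa>) (chart_image \<kappa>) (snd \<kappa>) (chart_inv \<kappa>)"

definition transition :: "('a, 'e) chart \<Rightarrow> ('a, 'e) chart \<Rightarrow> 'e \<Rightarrow> 'e" where
  "transition \<kappa> \<mu> = snd \<mu> \<circ> chart_inv \<kappa>"

definition smooth_atlas ::
  "('a::{t2_space, second_countable_topology}, 'e::euclidean_space) chart set \<Rightarrow> bool" where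
  "smooth_atlas A \<longleftrightarrow>
     (\<forall>\<kappa>\<in>A. is_chart \<kappa>) \<and> (\<Union>\<kappa>\<in>A. fst \<kappa>) = UNIV \<and>
     (\<forall>\<kappa>\<in>A. \<forall>\<mu>\<in>A. smooth_on (snd \<kappa> ` (fst \<kappa> \<inter> fst \<mu>)) (transition \<kappa> \<mu>))"

text \<open>
  A tangent vector at \<open>p\<close> is the family of its coordinate vectors in all charts around \<open>p\<close>,
  related by the differentials of the transition maps.  The value 0 at all other arguments makes
  the family unique, so that the tangent space is a linear subspace of a function space.
\<close>

type_synonym ('a, 'e) tvec = "('a, 'e) chart \<Rightarrow> 'e"

definition tangent_space ::
  "('a, 'e::euclidean_space) chart set \<Rightarrow> 'a \<Rightarrow> ('a, 'e) tvec set" where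
  "tangent_space A p = {v.
     (\<forall>\<kappa>\<in>A. \<forall>\<mu>\<in>A. p \<in> fst \<kappa> \<inter> fst \<mu> \<longrightarrow>
        v \<mu> = frechet_derivative (transition \<kappa> \<mu>) (at (snd \<kappa> p)) (v \<kappa>)) \<and>
     (\<forall>\<kappa>. \<not> (\<kappa> \<in> A \<and> p \<in> fst \<kappa>) \<longrightarrow> v \<kappa> = 0)}"

(* The tangent vector at p with coordinate vector u in the chart kappa. *)

definition coord_vec ::
  "('a, 'e::euclidean_space) chart set \<Rightarrow> ('a, 'e) chart \<Rightarrow> 'a \<Rightarrow> 'e \<Rightarrow> ('a, 'e) tvec" where
  "coord_vec A \<kappa> p u = (\<lambda>\<mu>. if \<mu> \<in> A \<and> p \<in> fst \<mu>
     then frechet_derivative (transition \<kappa> \<mu>) (at (snd \<kappa> p)) u else 0)"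

definition smooth_vector_field ::
  "('a, 'e::euclidean_space) chart set \<Rightarrow> ('a \<Rightarrow> ('a, 'e) tvec) \<Rightarrow> bool" where
  "smooth_vector_field A W \<longleftrightarrow>
     (\<forall>p. W p \<in> tangent_space A p) \<and>
     (\<forall>\<kappa>\<in>A. smooth_on (chart_image \<kappa>) (\<lambda>x. W (chart_inv \<kappa> x) \<kappa>))"


section \<open>Riemannian metrics and navigation data\<close>

(* A metric is only constrained on tangent vectors; its other values are junk. *)

type_synonym ('a, 'e) metric = "'a \<Rightarrow> ('a, 'e) tvec \<Rightarrow> ('a, 'e) tvec \<Rightarrow> real"

definition metric_coord ::
  "('a, 'e::euclidean_space) chart set \<Rightarrow> ('a, 'e) metric \<Rightarrow> ('a, 'e) chart
     \<Rightarrow> 'e \<Rightarrow> 'e \<Rightarrow> 'e \<Rightarrow> real" where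
  "metric_coord A h \<kappa> x u v =
     (let p = chart_inv \<kappa> x in h p (coord_vec A \<kappa> p u) (coord_vec A \<kappa> p v))"

definition riemannian_metric ::
  "('a, 'e::euclidean_space) chart set \<Rightarrow> ('a, 'e) metric \<Rightarrow> bool" where
  "riemannian_metric A h \<longleftrightarrow>
     (\<forall>p. \<forall>u\<in>tangent_space A p. \<forall>v\<in>tangent_space A p.
        h p u v = h p v u \<and>
        (\<forall>w\<in>tangent_space A p. \<forall>r s. h p (r *\<^sub>R u + s *\<^sub>R v) w = r * h p u w + s * h p v w)) \<and>
     (\<forall>p. \<forall>v\<in>tangent_space A p. v \<noteq> 0 \<longrightarrow> h p v v > 0) \<and>
     (\<forall>\<kappa>\<in>A. \<forall>u v. smooth_on (chart_image \<kappa>) (\<lambda>x. metric_coord A h \<kappa> x u v))"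

definition navigation_data ::
  "('a, 'e::euclidean_space) chart set \<Rightarrow> ('a, 'e) metric \<Rightarrow> ('a \<Rightarrow> ('a, 'e) tvec) \<Rightarrow> bool" where
  "navigation_data A h W \<longleftrightarrow>
     riemannian_metric A h \<and> smooth_vector_field A W \<and> (\<forall>p. h p (W p) (W p) < 1)"

definition randers_norm ::
  "('a, 'e) metric \<Rightarrow> ('a \<Rightarrow> ('a, 'e) tvec) \<Rightarrow> 'a \<Rightarrow> ('a, 'e) tvec \<Rightarrow> real" where
  "randers_norm h W p y =
     (let lam = 1 - h p (W p) (W p)
      in sqrt ((h p y (W p))\<^sup>2 + lam * h p y y) / lam - h p y (W p) / lam)"


section \<open>Levi-Civita parallel translation\<close>

text \<open>
  The curves are piecewise smooth and parametrised by a compact interval.  Smoothness on a closed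
  piece \<open>[\<tau> i, \<tau> (Suc i)]\<close> means being the restriction of a smooth curve on an open set.
\<close>

definition smooth_curve_on ::
  "('a::topological_space, 'e::euclidean_space) chart set \<Rightarrow> real set \<Rightarrow> (real \<Rightarrow> 'a) \<Rightarrow> bool" where
  "smooth_curve_on A J \<gamma> \<longleftrightarrow> open J \<and> continuous_on J \<gamma> \<and>
     (\<forall>\<kappa>\<in>A. smooth_on (J \<inter> \<gamma> -` fst \<kappa>) (snd \<kappa> \<circ> \<gamma>))"

definition piecewise_smooth_curve ::
  "('a::topological_space, 'e::euclidean_space) chart set
     \<Rightarrow> (real \<Rightarrow> 'a) \<Rightarrow> real \<Rightarrow> real \<Rightarrow> bool" where
  "piecewise_smooth_curve A c a b \<longleftrightarrow> a < b \<and>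
     (\<exists>n \<tau>. \<tau> 0 = a \<and> \<tau> n = b \<and>
        (\<forall>i<n. \<tau> i < \<tau> (Suc i) \<and>
           (\<exists>J \<gamma>. {\<tau> i..\<tau> (Suc i)} \<subseteq> J \<and> smooth_curve_on A J \<gamma> \<and>
                  (\<forall>t\<in>{\<tau> i..\<tau> (Suc i)}. c t = \<gamma> t))))"

text \<open>
  Christoffel symbols of the second kind, as the bilinear map \<open>\<Gamma>\<^sub>x(u, v)\<close>: the component formula
  \<open>g\<^sub>k\<^sub>l \<Gamma>\<^sup>l\<^sub>i\<^sub>j = (\<partial>\<^sub>i g\<^sub>j\<^sub>k + \<partial>\<^sub>j g\<^sub>i\<^sub>k - \<partial>\<^sub>k g\<^sub>i\<^sub>j) / 2\<close> contracted with \<open>u\<^sup>i v\<^sup>j w\<^sup>k\<close>.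
  Nondegeneracy of the metric makes the description unique.
\<close>

definition christoffel ::
  "('a, 'e::euclidean_space) chart set \<Rightarrow> ('a, 'e) metric \<Rightarrow> ('a, 'e) chart
     \<Rightarrow> 'e \<Rightarrow> 'e \<Rightarrow> 'e \<Rightarrow> 'e" where
  "christoffel A h \<kappa> x u v =
     (let g = metric_coord A h \<kappa>;
          dg = (\<lambda>d y z. frechet_derivative (\<lambda>x. g x y z) (at x) d)
      in THE \<Gamma>. \<forall>w. g x \<Gamma> w = (dg u v w + dg v u w - dg w u v) / 2)"

text \<open>
  \<open>V\<close> is a parallel vector field along \<open>c\<close> if in every chart
  \<open>dV\<^sup>k/dt + \<Gamma>\<^sup>k\<^sub>i\<^sub>j(c) (dc\<^sup>i/dt) V\<^sup>j = 0\<close>.  The field is continuous, and finitely many parameters,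
  among them the break points of \<open>c\<close>, are exempt from the equation.
\<close>

definition parallel_along ::
  "('a, 'e::euclidean_space) chart set \<Rightarrow> ('a, 'e) metric \<Rightarrow> (real \<Rightarrow> 'a) \<Rightarrow> real \<Rightarrow> real
     \<Rightarrow> (real \<Rightarrow> ('a, 'e) tvec) \<Rightarrow> bool" where
  "parallel_along A h c a b V \<longleftrightarrow>
     (\<forall>t\<in>{a..b}. V t \<in> tangent_space A (c t)) \<and>
     (\<forall>\<kappa>\<in>A. continuous_on ({a..b} \<inter> c -` fst \<kappa>) (\<lambda>t. V t \<kappa>)) \<and>
     (\<exists>S. finite S \<and>
        (\<forall>t\<in>{a<..<b} - S. \<forall>\<kappa>\<in>A. c t \<in> fst \<kappa> \<longrightarrow>
           ((\<lambda>s. V s \<kappa>) has_vector_derivative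
              - christoffel A h \<kappa> (snd \<kappa> (c t)) (vector_derivative (snd \<kappa> \<circ> c) (at t)) (V t \<kappa>))
             (at t)))"

definition levi_civita_translation ::
  "('a, 'e::euclidean_space) chart set \<Rightarrow> ('a, 'e) metric \<Rightarrow> (real \<Rightarrow> 'a) \<Rightarrow> real \<Rightarrow> real
     \<Rightarrow> ('a, 'e) tvec \<Rightarrow> ('a, 'e) tvec" where
  "levi_civita_translation A h c a b v =
     (THE w. \<exists>V. parallel_along A h c a b V \<and> V a = v \<and> V b = w)"


section \<open>Natural parallel translation\<close>

(* The translation of unit vectors, with p = c a and q = c b. *)

definition natural_translation_unit ::
  "('a, 'e::euclidean_space) chart set \<Rightarrow> ('a, 'e) metric \<Rightarrow> ('a \<Rightarrow> ('a, 'e) tvec)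
     \<Rightarrow> (real \<Rightarrow> 'a) \<Rightarrow> real \<Rightarrow> real \<Rightarrow> ('a, 'e) tvec \<Rightarrow> ('a, 'e) tvec" where
  "natural_translation_unit A h W c a b v =
     levi_civita_translation A h c a b (v - W (c a)) + W (c b)"

definition natural_translation ::
  "('a, 'e::euclidean_space) chart set \<Rightarrow> ('a, 'e) metric \<Rightarrow> ('a \<Rightarrow> ('a, 'e) tvec)
     \<Rightarrow> (real \<Rightarrow> 'a) \<Rightarrow> real \<Rightarrow> real \<Rightarrow> ('a, 'e) tvec \<Rightarrow> ('a, 'e) tvec" where
  "natural_translation A h W c a b v =
     (let F = randers_norm h W (c a) v
      in F *\<^sub>R natural_translation_unit A h W c a b ((1 / F) *\<^sub>R v))"

end

theory Submission
  imports Defs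
begin

text \<open>
  Since \<open>\<F>(y) = 1\<close> exactly when \<open>|y - W| = 1\<close>, the \<open>\<F>\<close>-unit sphere at every point is the \<open>h\<close>-unit sphere
  translated by \<open>W\<close>.  Levi-Civita translation is a linear isometry for \<open>h\<close>, hence conjugating it with
  these translations maps unit sphere to unit sphere, which is (2).  The analytic content is that
  Levi-Civita translation is well defined.  Uniqueness follows from metric compatibility, applied to the
  difference of two parallel fields.  Existence holds on short intervals by Picard iteration in
  one chart; that the local solution satisfies the equation in every other chart is the transformation
  law of the Christoffel symbols, and a bisection argument covers the whole curve.

  For (3), take the given metric and a wind supported in a small coordinate ball, and go along a
  coordinate segment from a boundary point of the ball, where \<open>W = 0\<close>, to the centre \<open>q\<close>.  Then
  \<open>\<P>(v) = \<P>\<^sub>R(v) + |v| W\<^sub>q\<close>, which fails to be additive on \<open>u\<close> and \<open>-u/2\<close>.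
\<close>

section \<open>Calculus of smooth functions\<close>

text \<open>The nonadditive example has to live on the given atlas, so no convenient model manifold
  may be chosen: a wind supported in one chart is available on every manifold, and keeping the given
  metric avoids constructing another one. As Levi-Civita translation is linear, additivity can fail
  only through the length in front of the wind at the end point. The vectors u and -u/2 expose this
  already in dimension one, where vectors of the same direction would not, and unlike u and -u they
  have a nonzero sum.

  On the analytic side, \<open>christoffel\<close> and \<open>levi_civita_translation\<close> are
  definite descriptions, so their properties become accessible only through existence and
  uniqueness; even the continuity of the Christoffel symbols along a curve is extracted from their
  defining equation. A parallel field must satisfy its equation in all charts at once, whereas an
  ODE solution is produced in one. The change of chart introduces second derivatives of the
  transition map, and their symmetry is what makes the Christoffel symbols absorb them.\<close>

lemma Ck_on_SucD:
  assumes "Ck_on (Suc k) S f" "open S"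
  shows "x \<in> S \<Longrightarrow> (f has_derivative frechet_derivative f (at x)) (at x)"
    and "Ck_on k S (\<lambda>x. frechet_derivative f (at x) v)"
  using assms
  by (auto simp: frechet_derivative_works[symmetric] differentiable_on_eq_differentiable_at)

text \<open>Openness matters here: \<open>frechet_derivative f (at x)\<close> is determined by the
  values of f near x, so equality on an open set passes to derivatives of all orders.\<close>

lemma Ck_on_cong:
  assumes "open S" "\<And>x. x \<in> S \<Longrightarrow> f x = g x"
  shows "Ck_on k S f \<longleftrightarrow> Ck_on k S g"
  using assms(2)
proof (induction k arbitrary: f g)
  case 0
  then show ?case by (simp cong: continuous_on_cong)
next
  case (Suc k)
  have D: "frechet_derivative f (at x) = frechet_derivative g (at x)" if "x \<in> S" for x
  proof -
    have "(f has_derivative F) (at x) \<longleftrightarrow> (g has_derivative F) (at x)" for F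
      using has_derivative_transform_within_open[OF _ assms(1) that] Suc.prems by metis
    then show ?thesis by (simp add: frechet_derivative_def)
  qed
  have "f differentiable_on S \<longleftrightarrow> g differentiable_on S"
    using Suc.prems has_derivative_transform[of _ S] unfolding differentiable_on_def differentiable_def
    by metis
  moreover have "Ck_on k S (\<lambda>x. frechet_derivative f (at x) v)
      \<longleftrightarrow> Ck_on k S (\<lambda>x. frechet_derivative g (at x) v)" for v
    by (rule Suc.IH) (simp add: D)
  ultimately show ?case by simp
qed

text \<open>An explicit derivative D may stand in for the chosen \<open>frechet_derivative\<close>,
  since derivatives at a point are unique. The later inductions on the order k use this
  form.\<close>

lemma Ck_on_SucI:
  assumes "open S" "\<And>x. x \<in> S \<Longrightarrow> (f has_derivative D x) (at x)"
    and "\<And>v. Ck_on k S (\<lambda>x. D x v)"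
  shows "Ck_on (Suc k) S f"
proof -
  have "f differentiable_on S"
    using assms(1,2) by (auto simp: differentiable_on_eq_differentiable_at differentiable_def)
  moreover have "Ck_on k S (\<lambda>x. frechet_derivative f (at x) v)" for v
    using Ck_on_cong[OF assms(1), of "\<lambda>x. frechet_derivative f (at x) v" "\<lambda>x. D x v"]
      assms(2,3) frechet_derivative_at by metis
  ultimately show ?thesis by simp
qed

lemma Ck_on_locally:
  assumes "\<And>x. x \<in> S \<Longrightarrow> \<exists>T. open T \<and> x \<in> T \<and> Ck_on k T f"
  shows "Ck_on k S f"
  using assms
proof (induction k arbitrary: f)
  case 0
  have "isCont f x" if "x \<in> S" for x
    using 0[OF that] continuous_on_eq_continuous_at by auto
  then show ?case by (simp add: continuous_at_imp_continuous_on)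
next
  case (Suc k)
  have "f differentiable (at x)" if "x \<in> S" for x
    using Suc.prems[OF that] by (auto simp: differentiable_on_eq_differentiable_at)
  moreover have "Ck_on k S (\<lambda>x. frechet_derivative f (at x) v)" for v
    by (rule Suc.IH) (use Suc.prems in fastforce)
  ultimately show ?case by (simp add: differentiable_at_imp_differentiable_on)
qed

lemma Ck_on_const: "Ck_on k S (\<lambda>x. c)"
  by (induction k arbitrary: c) auto

text \<open>The definition of order k+1 speaks about the derivatives only, so losing an order takes
  an induction. Product and chain rule rely on it: their derivatives contain f itself beside its
  derivative.\<close>

lemma Ck_on_Suc_imp: "Ck_on (Suc k) S f \<Longrightarrow> Ck_on k S f"
proof (induction k arbitrary: f)
  case 0
  then show ?case by (simp add: differentiable_imp_continuous_on)
next
  case (Suc k)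
  then show ?case by (metis Ck_on.simps(2))
qed

lemma Ck_on_add:
  assumes "open S" "Ck_on k S f" "Ck_on k S g"
  shows "Ck_on k S (\<lambda>x. f x + g x)"
  using assms(2,3)
proof (induction k arbitrary: f g)
  case 0
  then show ?case by (simp add: continuous_on_add)
next
  case (Suc k)
  show ?case
    by (rule Ck_on_SucI[OF assms(1) has_derivative_add[OF Ck_on_SucD(1)[OF Suc.prems(1) assms(1)]
              Ck_on_SucD(1)[OF Suc.prems(2) assms(1)]]], assumption+)
      (intro Suc.IH Ck_on_SucD(2)[OF Suc.prems(1) assms(1)] Ck_on_SucD(2)[OF Suc.prems(2) assms(1)])
qed

lemma Ck_on_sum:
  assumes "open S" "\<And>i. i \<in> I \<Longrightarrow> Ck_on k S (f i)"
  shows "Ck_on k S (\<lambda>x. \<Sum>i\<in>I. f i x)"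
  using assms(2)
  by (induction I rule: infinite_finite_induct) (auto intro!: Ck_on_const Ck_on_add[OF assms(1)])

lemma (in bounded_bilinear) Ck_on:
  assumes "open S" "Ck_on k S f" "Ck_on k S g"
  shows "Ck_on k S (\<lambda>x. prod (f x) (g x))"
  using assms(2,3)
proof (induction k arbitrary: f g)
  case 0
  then show ?case by (simp add: continuous_on)
next
  case (Suc k)
  show ?case
    by (rule Ck_on_SucI[OF assms(1) FDERIV[OF Ck_on_SucD(1)[OF Suc.prems(1) assms(1)]
              Ck_on_SucD(1)[OF Suc.prems(2) assms(1)]]], assumption+)
      (intro Ck_on_add assms(1) Suc.IH Ck_on_SucD(2)[OF Suc.prems(1)]
        Ck_on_SucD(2)[OF Suc.prems(2)] Suc.prems[THEN Ck_on_Suc_imp])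
qed

text \<open>The chain rule applies a varying linear map to a varying vector, which the induction
  hypothesis cannot treat directly. Expanding the vector in the basis leaves products of coordinates
  of the derivative of f with functions of the form g'(f x) b for a fixed direction b; these are
  compositions again, with g replaced by a directional derivative of order k.\<close>

lemma Ck_on_compose:
  fixes f :: "'x::euclidean_space \<Rightarrow> 'y::euclidean_space"
    and g :: "'y \<Rightarrow> 'z::real_normed_vector"
  assumes "open S" "open T" "f ` S \<subseteq> T" "Ck_on k S f" "Ck_on k T g"
  shows "Ck_on k S (\<lambda>x. g (f x))"
  using assms(4,5)
proof (induction k arbitrary: g)
  case 0
  then show ?case using assms(3) by (auto intro: continuous_on_compose2)
next
  case (Suc k)
  have "Ck_on k S (\<lambda>x. \<Sum>b\<in>Basis. (frechet_derivative f (at x) v \<bullet> b)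
            *\<^sub>R frechet_derivative g (at (f x)) b)" for v
    by (intro Ck_on_sum bounded_bilinear.Ck_on[OF bounded_bilinear_scaleR]
          bounded_bilinear.Ck_on[OF bounded_bilinear_inner] Ck_on_const assms(1)
          Ck_on_SucD(2)[OF Suc.prems(1)]
          Suc.IH[OF Ck_on_Suc_imp[OF Suc.prems(1)] Ck_on_SucD(2)[OF Suc.prems(2) assms(2)]])
  moreover have "((\<lambda>x. g (f x)) has_derivative (\<lambda>v. \<Sum>b\<in>Basis. (frechet_derivative f (at x) v \<bullet> b)
            *\<^sub>R frechet_derivative g (at (f x)) b)) (at x)" if "x \<in> S" for x
  proof -
    have g: "(g has_derivative frechet_derivative g (at (f x))) (at (f x))"
      using Suc.prems assms that by (intro Ck_on_SucD(1)[of k T]) auto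
    interpret bounded_linear "frechet_derivative g (at (f x))"
      using g by (rule has_derivative_bounded_linear)
    have "frechet_derivative g (at (f x)) (frechet_derivative f (at x) v) =
        (\<Sum>b\<in>Basis. (frechet_derivative f (at x) v \<bullet> b) *\<^sub>R frechet_derivative g (at (f x)) b)" for v
      by (subst euclidean_representation[symmetric, of "frechet_derivative f (at x) v"])
        (simp only: sum scaleR)
    then show ?thesis
      using has_derivative_compose[OF Ck_on_SucD(1)[OF Suc.prems(1) assms(1) that] g] by simp
  qed
  ultimately show ?case by (intro Ck_on_SucI[OF assms(1)])
qed

section \<open>Rules for smooth functions of all orders\<close>

lemma smooth_on_eq:
  "open S \<Longrightarrow> smooth_on S f \<Longrightarrow> (\<And>x. x \<in> S \<Longrightarrow> f x = g x) \<Longrightarrow> smooth_on S g"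
  using Ck_on_cong unfolding smooth_on_def by blast

lemma smooth_on_locally:
  assumes "\<And>x. x \<in> S \<Longrightarrow> \<exists>T. open T \<and> x \<in> T \<and> smooth_on T f"
  shows "smooth_on S f"
  using assms Ck_on_locally unfolding smooth_on_def by meson

lemma smooth_on_const: "smooth_on S (\<lambda>x. c)"
  by (simp add: smooth_on_def Ck_on_const)

lemma smooth_on_add:
  "open S \<Longrightarrow> smooth_on S f \<Longrightarrow> smooth_on S g \<Longrightarrow> smooth_on S (\<lambda>x. f x + g x)"
  by (simp add: smooth_on_def Ck_on_add)

lemma (in bounded_bilinear) smooth_on:
  "open S \<Longrightarrow> smooth_on S f \<Longrightarrow> smooth_on S g \<Longrightarrow> smooth_on S (\<lambda>x. prod (f x) (g x))"
  by (simp add: smooth_on_def Ck_on)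

lemmas smooth_on_scaleR = bounded_bilinear.smooth_on[OF bounded_bilinear_scaleR]
  and smooth_on_inner = bounded_bilinear.smooth_on[OF bounded_bilinear_inner]

lemma smooth_on_compose:
  fixes f :: "'x::euclidean_space \<Rightarrow> 'y::euclidean_space"
  assumes "open S" "open T" "f ` S \<subseteq> T" "smooth_on S f" "smooth_on T g"
  shows "smooth_on S (\<lambda>x. g (f x))"
  using assms(4,5) Ck_on_compose[OF assms(1-3), of _ g] unfolding smooth_on_def by blast

lemma smooth_on_bounded_linear:
  assumes "bounded_linear f" "open S"
  shows "smooth_on S f"
  unfolding smooth_on_def
proof
  show "Ck_on k S f" for k
  proof (cases k)
    case 0
    then show ?thesis using assms by (simp add: linear_continuous_on)
  next
    case (Suc m)
    then show ?thesis
      using Ck_on_SucI[OF assms(2) bounded_linear_imp_has_derivative[OF assms(1)] Ck_on_const] by simp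
  qed
qed

lemma smooth_on_has_derivative:
  "smooth_on S f \<Longrightarrow> open S \<Longrightarrow> x \<in> S \<Longrightarrow> (f has_derivative frechet_derivative f (at x)) (at x)"
  using Ck_on_SucD(1)[of 0 S f] unfolding smooth_on_def by auto

lemma smooth_on_frechet_derivative:
  assumes "smooth_on S f"
  shows "smooth_on S (\<lambda>x. frechet_derivative f (at x) v)"
  unfolding smooth_on_def
proof
  show "Ck_on k S (\<lambda>x. frechet_derivative f (at x) v)" for k
    using assms[unfolded smooth_on_def, rule_format, of "Suc k"] by simp
qed

lemma smooth_on_imp_continuous_on: "smooth_on S f \<Longrightarrow> continuous_on S f"
  unfolding smooth_on_def by (meson Ck_on.simps(1))

section \<open>A bump function\<close>

text \<open>The factor \<open>p(1/t)\<close> makes the family closed under differentiation.\<close>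

definition flat_exp :: "real poly \<Rightarrow> real \<Rightarrow> real" where
  "flat_exp p t = (if t > 0 then poly p (1 / t) * exp (- (1 / t)) else 0)"

lemma poly_times_exp_minus_tendsto_0: "((\<lambda>x. poly p x * exp (- x)) \<longlongrightarrow> (0::real)) at_top"
proof -
  have "((\<lambda>x. \<Sum>i\<le>degree p. coeff p i * (x ^ i / exp x)) \<longlongrightarrow> (\<Sum>i\<le>degree p. coeff p i * 0)) at_top"
    by (intro tendsto_sum tendsto_mult tendsto_const tendsto_power_div_exp_0)
  then show ?thesis
    by (simp add: poly_altdef sum_distrib_right exp_minus divide_inverse mult.assoc)
qed

lemma flat_exp_tendsto_0: "(flat_exp p \<longlongrightarrow> 0) (at 0)"
proof -
  have "((\<lambda>t. poly p (inverse t) * exp (- inverse t)) \<longlongrightarrow> 0) (at_right (0::real))"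
    by (rule filterlim_compose[OF poly_times_exp_minus_tendsto_0 filterlim_inverse_at_top_right])
  then have "(flat_exp p \<longlongrightarrow> 0) (at_right 0)"
    by (rule Lim_transform_eventually)
      (auto simp: flat_exp_def eventually_at_right_field inverse_eq_divide intro: exI[of _ 1])
  moreover have "(flat_exp p \<longlongrightarrow> 0) (at_left 0)"
    by (rule Lim_transform_eventually[OF tendsto_const])
      (auto simp: flat_exp_def eventually_at_left_field intro: exI[of _ "-1"])
  ultimately show ?thesis by (simp add: filterlim_split_at)
qed

text \<open>For t > 0 the derivative of p(1/t) exp(-1/t) is (p - p')(1/t) exp(-1/t) / t^2, and
  \<open>[:0, 0, 1:]\<close> is the polynomial X^2 that accounts for the factor 1/t^2.\<close>

lemma has_real_derivative_flat_exp:
  "(flat_exp p has_real_derivative flat_exp ([:0, 0, 1:] * (p - pderiv p)) t) (at t)"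
proof -
  consider "t > 0" | "t < 0" | "t = 0" by linarith
  then show ?thesis
  proof cases
    case 1
    have "((\<lambda>t. poly p (1 / t) * exp (- (1 / t))) has_real_derivative
        flat_exp ([:0, 0, 1:] * (p - pderiv p)) t) (at t)"
      using 1 by (auto intro!: derivative_eq_intros simp: flat_exp_def field_simps power2_eq_square)
    then show ?thesis
      by (rule has_field_derivative_transform_within_open[of _ _ _ "{0<..}"])
        (use 1 in \<open>auto simp: flat_exp_def\<close>)
  next
    case 2
    have "((\<lambda>t. 0) has_real_derivative flat_exp ([:0, 0, 1:] * (p - pderiv p)) t) (at t)"
      using 2 by (simp add: flat_exp_def)
    then show ?thesis
      by (rule has_field_derivative_transform_within_open[of _ _ _ "{..<0}"])
        (use 2 in \<open>auto simp: flat_exp_def\<close>)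
  next
    case 3
    \<comment> \<open>Division by h multiplies the polynomial by X, so the difference quotient at 0
      belongs to the family and its limit is known.\<close>
    have "(flat_exp p (0 + h) - flat_exp p 0) / h = flat_exp ([:0, 1:] * p) h" for h
      by (simp add: flat_exp_def field_simps)
    then show ?thesis
      using 3 flat_exp_tendsto_0[of "[:0, 1:] * p"] by (simp add: DERIV_def flat_exp_def[of _ 0])
  qed
qed

lemma smooth_on_flat_exp: "smooth_on UNIV (flat_exp p)"
proof -
  have "Ck_on k UNIV (flat_exp p)" for k
  proof (induction k arbitrary: p)
    case 0
    then show ?case
      using DERIV_isCont[OF has_real_derivative_flat_exp]
      by (simp add: continuous_at_imp_continuous_on)
  next
    case (Suc k)
    show ?case
      by (rule Ck_on_SucI[OF _ has_real_derivative_flat_exp[unfolded has_field_derivative_def]])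
        (intro bounded_bilinear.Ck_on[OF bounded_bilinear_mult] open_UNIV Suc.IH Ck_on_const)+
  qed
  then show ?thesis by (simp add: smooth_on_def)
qed

lemma bump_function_exists:
  fixes x0 :: "'e::euclidean_space"
  assumes "r > 0"
  obtains \<psi> :: "'e \<Rightarrow> real" where "smooth_on UNIV \<psi>" "\<psi> x0 > 0" "\<And>x. dist x0 x \<ge> r \<Longrightarrow> \<psi> x = 0"
proof
  \<comment> \<open>The argument is r^2 - |x - x0|^2, positive exactly inside the ball of radius r.
    It is spelled with sums, scalings and inner products to match the smoothness rules.\<close>
  let ?\<psi> = "\<lambda>x. flat_exp 1 (r\<^sup>2 + - 1 *\<^sub>R ((x + - x0) \<bullet> (x + - x0)))"
  show "smooth_on UNIV ?\<psi>"
    by (intro smooth_on_compose[OF _ _ _ _ smooth_on_flat_exp] smooth_on_add smooth_on_const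
        smooth_on_scaleR smooth_on_inner smooth_on_bounded_linear bounded_linear_ident) auto
  show "?\<psi> x0 > 0" using assms by (simp add: flat_exp_def)
  show "?\<psi> x = 0" if "dist x0 x \<ge> r" for x
  proof -
    have "r\<^sup>2 \<le> (norm (x - x0))\<^sup>2"
      using that assms by (intro power_mono) (auto simp: dist_norm norm_minus_commute)
    then show ?thesis by (simp add: flat_exp_def power2_norm_eq_inner)
  qed
qed

section \<open>Families of linear and bilinear maps\<close>

lemma linear_eq_sum_Basis:
  fixes f :: "'e::euclidean_space \<Rightarrow> 'f::real_normed_vector"
  assumes "linear f"
  shows "f v = (\<Sum>b\<in>Basis. (v \<bullet> b) *\<^sub>R f b)"
  by (subst euclidean_representation[symmetric, of v]) (simp only: linear_sum[OF assms] linear_scale[OF assms])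

text \<open>A product rule for maps whose dependence on the parameter is known only for each fixed
  argument. Expansion in the finite basis reduces it to a sum of scalar multiples. Linearity is
  required only near t because coordinate expressions of tensors are linear only at points of the
  chart image.\<close>

lemma has_vector_derivative_linear_family:
  fixes \<Phi> :: "real \<Rightarrow> 'e::euclidean_space \<Rightarrow> 'f::real_normed_vector"
  assumes lin: "eventually (\<lambda>s. linear (\<Phi> s)) (nhds t)"
    and \<Phi>': "\<And>w. ((\<lambda>s. \<Phi> s w) has_vector_derivative \<Phi>' w) (at t)"
    and v': "(v has_vector_derivative v') (at t)"
  shows "((\<lambda>s. \<Phi> s (v s)) has_vector_derivative \<Phi>' (v t) + \<Phi> t v') (at t)"
proof -
  have lin_t: "linear (\<Phi> t)" using eventually_nhds_x_imp_x[OF lin] .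
  obtain T where T: "open T" "t \<in> T" "\<And>s. s \<in> T \<Longrightarrow> linear (\<Phi> s)"
    using lin unfolding eventually_nhds by blast
  have sum': "((\<lambda>s. \<Phi> s (w s)) has_vector_derivative
      (\<Sum>b\<in>Basis. (w t \<bullet> b) *\<^sub>R \<Phi>' b + (w' \<bullet> b) *\<^sub>R \<Phi> t b)) (at t)"
    if w': "(w has_vector_derivative w') (at t)" for w w'
  proof -
    have "((\<lambda>s. w s \<bullet> b) has_real_derivative w' \<bullet> b) (at t)" for b
      using bounded_linear.has_vector_derivative[OF bounded_linear_inner_left w']
      by (simp add: has_real_derivative_iff_has_vector_derivative)
    then have "((\<lambda>s. \<Sum>b\<in>Basis. (w s \<bullet> b) *\<^sub>R \<Phi> s b) has_vector_derivative
        (\<Sum>b\<in>Basis. (w t \<bullet> b) *\<^sub>R \<Phi>' b + (w' \<bullet> b) *\<^sub>R \<Phi> t b)) (at t)"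
      by (intro has_vector_derivative_sum has_vector_derivative_scaleR \<Phi>')
    then show ?thesis
      using T linear_eq_sum_Basis[of "\<Phi> _"]
      by (auto elim!: has_vector_derivative_transform_within_open[where S=T])
  qed
  \<comment> \<open>Linearity of \<Phi>' is not among the hypotheses. The expansion applied to the
    constant curve with value v t, together with uniqueness of the derivative, supplies its
    coordinates.\<close>
  have "\<Phi>' (v t) = (\<Sum>b\<in>Basis. (v t \<bullet> b) *\<^sub>R \<Phi>' b + (0 \<bullet> b) *\<^sub>R \<Phi> t b)"
    by (rule vector_derivative_unique_at[OF \<Phi>' sum']) simp
  then show ?thesis
    using sum'[OF v'] linear_eq_sum_Basis[OF lin_t, of v'] by (simp add: sum.distrib)
qed

lemma has_vector_derivative_bilinear_family:
  fixes B :: "real \<Rightarrow> 'e::euclidean_space \<Rightarrow> 'f::euclidean_space \<Rightarrow> 'g::real_normed_vector"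
  assumes bil: "eventually (\<lambda>s. bilinear (B s)) (nhds t)"
    and B': "\<And>w z. ((\<lambda>s. B s w z) has_vector_derivative B' w z) (at t)"
    and v': "(v has_vector_derivative v') (at t)"
    and u': "(u has_vector_derivative u') (at t)"
  shows "((\<lambda>s. B s (v s) (u s)) has_vector_derivative
            B' (v t) (u t) + B t v' (u t) + B t (v t) u') (at t)"
proof -
  have "((\<lambda>s. B s w (u s)) has_vector_derivative B' w (u t) + B t w u') (at t)" for w
    by (rule has_vector_derivative_linear_family[OF _ B' u'])
      (use bil in eventually_elim, simp add: bilinear_def)
  then have "((\<lambda>s. B s (v s) (u s)) has_vector_derivative
      (B' (v t) (u t) + B t (v t) u') + B t v' (u t)) (at t)"
    by (rule has_vector_derivative_linear_family[where \<Phi>="\<lambda>s w. B s w (u s)", rotated])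
      (use v' bil in \<open>auto simp: bilinear_def elim: eventually_mono\<close>)
  then show ?thesis by (simp add: algebra_simps)
qed

lemma continuous_on_linear_family:
  fixes \<Phi> :: "'t::topological_space \<Rightarrow> 'e::euclidean_space \<Rightarrow> 'f::real_normed_vector"
  assumes "\<And>s. s \<in> T \<Longrightarrow> linear (\<Phi> s)" "\<And>w. continuous_on T (\<lambda>s. \<Phi> s w)" "continuous_on T v"
  shows "continuous_on T (\<lambda>s. \<Phi> s (v s))"
proof -
  have "continuous_on T (\<lambda>s. \<Sum>b\<in>Basis. (v s \<bullet> b) *\<^sub>R \<Phi> s b)"
    by (intro continuous_intros assms)
  then show ?thesis
    by (rule continuous_on_eq) (rule linear_eq_sum_Basis[OF assms(1), symmetric])
qed

lemma continuous_on_bilinear_family: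
  fixes B :: "'t::topological_space \<Rightarrow> 'e::euclidean_space \<Rightarrow> 'f::euclidean_space \<Rightarrow> 'g::real_normed_vector"
  assumes "\<And>s. s \<in> T \<Longrightarrow> bilinear (B s)" "\<And>w z. continuous_on T (\<lambda>s. B s w z)"
    and "continuous_on T v" "continuous_on T u"
  shows "continuous_on T (\<lambda>s. B s (v s) (u s))"
proof -
  have "continuous_on T (\<lambda>s. B s w (u s))" for w
    by (rule continuous_on_linear_family[where \<Phi>="\<lambda>s. B s w", OF _ assms(2,4)])
      (use assms(1) in \<open>simp add: bilinear_def\<close>)
  then show ?thesis
    by (rule continuous_on_linear_family[where \<Phi>="\<lambda>s w. B s w (u s)", OF _ _ assms(3), rotated])
      (use assms(1) in \<open>simp add: bilinear_def\<close>)
qed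

text \<open>The map sending z to the vector with coordinates B z b is linear, and injective by
  positivity of B; in finite dimension it is therefore surjective. Only definiteness is used here,
  so B may be nonsymmetric.\<close>

lemma bilinear_riesz:
  fixes B :: "'e::euclidean_space \<Rightarrow> 'e \<Rightarrow> real"
  assumes "bilinear B" "\<And>w. w \<noteq> 0 \<Longrightarrow> B w w > 0" "linear l"
  shows "\<exists>!z. \<forall>w. B z w = l w"
proof -
  have lin: "linear (B z)" "linear (\<lambda>z. B z w)" for z w
    using assms(1) by (auto simp: bilinear_def)
  let ?f = "\<lambda>z. \<Sum>b\<in>Basis. B z b *\<^sub>R b"
  have eq0: "z = 0" if "\<And>w. B z w = 0" for z
    using assms(2)[of z] that by force
  have f: "linear ?f"
    by (intro linear_compose_sum ballI linear_compose_scale_right[OF lin(2), unfolded o_def])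
      (auto intro!: linearI simp: linear_add[OF lin(2)] linear_scale[OF lin(2)] algebra_simps)
  have comp: "?f z \<bullet> b = B z b" if "b \<in> Basis" for z b
    using that by simp
  have "inj ?f"
  proof (subst linear_injective_0[OF f], intro allI impI eq0)
    fix z w assume "?f z = 0"
    then have "B z b = 0" if "b \<in> Basis" for b using comp[OF that, of z] by simp
    then show "B z w = 0" using linear_eq_sum_Basis[OF lin(1), of z w] by simp
  qed
  then have "surj ?f" using linear_injective_imp_surjective[OF f] by simp
  then obtain z where z: "(\<Sum>b\<in>Basis. l b *\<^sub>R b) = ?f z" by (rule surjE)
  have Bz: "B z b = l b" if "b \<in> Basis" for b
  proof -
    have "B z b = (\<Sum>b\<in>Basis. l b *\<^sub>R b) \<bullet> b" by (simp only: comp[OF that] z)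
    also have "\<dots> = l b" using that by simp
    finally show ?thesis .
  qed
  have z_sol: "B z w = l w" for w
    using linear_eq_sum_Basis[OF lin(1), of z w] linear_eq_sum_Basis[OF assms(3), of w] by (simp add: Bz)
  show ?thesis
  proof (intro ex1I[of _ z] allI z_sol)
    fix y assume y: "\<forall>w. B y w = l w"
    have "B (y - z) w = 0" for w
      using y z_sol by (simp add: linear_diff[OF lin(2)])
    then have "y - z = 0" by (rule eq0)
    then show "y = z" by simp
  qed
qed

text \<open>Continuity of the solution of B_s(z_s, w) = l_s(w) without inverting a matrix. Near t
  the forms B_s are coercive with a common constant m, so m |z_s - z_t|^2 is at most B_s(z_s - z_t,
  z_s - z_t), and the latter is controlled by the residuals B_s(z_s, b) - B_s(z_t, b), which tend to
  0.\<close>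

lemma continuous_on_bilinear_solution:
  fixes B :: "'t::topological_space \<Rightarrow> 'e::euclidean_space \<Rightarrow> 'e \<Rightarrow> real"
  assumes bil: "\<And>s. s \<in> T \<Longrightarrow> bilinear (B s)"
    and pos: "\<And>s w. s \<in> T \<Longrightarrow> w \<noteq> 0 \<Longrightarrow> B s w w > 0"
    and cont: "\<And>w z. continuous_on T (\<lambda>s. B s w z)"
    and sol: "\<And>w. continuous_on T (\<lambda>s. B s (z s) w)"
  shows "continuous_on T z"
  unfolding continuous_on_def
proof
  fix t assume t: "t \<in> T"
  have "continuous_on (sphere 0 1) (\<lambda>w. B t w w)"
    by (rule continuous_on_bilinear_family[where B="\<lambda>_. B t", OF bil[OF t] continuous_on_const
          continuous_on_id continuous_on_id])
  moreover obtain e :: 'e where "e \<in> Basis" using nonempty_Basis by blast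
  then have "e \<in> sphere 0 1" by simp
  then have "sphere (0::'e) 1 \<noteq> {}" by blast
  ultimately obtain w0 where "w0 \<in> sphere 0 1" "\<forall>w\<in>sphere 0 1. B t w0 w0 \<le> B t w w"
    using continuous_attains_inf[OF compact_sphere, of "0::'e" 1 "\<lambda>w. B t w w"] by blast
  then have w0: "norm w0 = 1" "\<And>w. norm w = 1 \<Longrightarrow> B t w0 w0 \<le> B t w w" by auto
  \<comment> \<open>Half of the minimum over the unit sphere: the other half is reserved for the
    deviation of B s from B t.\<close>
  define m where "m = B t w0 w0 / 2"
  have m: "m > 0" using pos[OF t, of w0] w0(1) by (cases "w0 = 0") (simp_all add: m_def)
  \<comment> \<open>The coordinates of a unit vector are at most 1 in absolute value, so \<delta>
    bounds the difference of the two quadratic forms on the unit sphere.\<close>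
  define \<delta> where "\<delta> s = (\<Sum>i\<in>Basis. \<Sum>j\<in>Basis. \<bar>B s i j - B t i j\<bar>)" for s
  have lower: "m * (norm w)\<^sup>2 \<le> B s w w" if s: "s \<in> T" "\<delta> s < m" for s w
  proof (cases "w = 0")
    case True
    then show ?thesis using bilinear_lzero[OF bil[OF s(1)]] by simp
  next
    case False
    define x where "x = w /\<^sub>R norm w"
    have x: "norm x = 1" "w = norm w *\<^sub>R x" using False by (simp_all add: x_def)
    have expand: "B s x x = (\<Sum>i\<in>Basis. \<Sum>j\<in>Basis. (x \<bullet> i) * ((x \<bullet> j) * B s i j))" if "s \<in> T" for s
    proof -
      have lin: "linear (\<lambda>u. B s u x)" "linear (B s i)" for i
        using bil[OF that] by (auto simp: bilinear_def)
      have "B s x x = (\<Sum>i\<in>Basis. (x \<bullet> i) * B s i x)"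
        using linear_eq_sum_Basis[OF lin(1), of x] by simp
      also have "\<dots> = (\<Sum>i\<in>Basis. (x \<bullet> i) * (\<Sum>j\<in>Basis. (x \<bullet> j) * B s i j))"
        using linear_eq_sum_Basis[OF lin(2), of _ x] by (intro sum.cong refl arg_cong2[where f="(*)"]) simp
      finally show ?thesis by (simp add: sum_distrib_left)
    qed
    have "\<bar>B s x x - B t x x\<bar> = \<bar>\<Sum>i\<in>Basis. \<Sum>j\<in>Basis. (x \<bullet> i) * ((x \<bullet> j) * (B s i j - B t i j))\<bar>"
      by (simp add: expand s(1) t sum_subtractf right_diff_distrib)
    also have "\<dots> \<le> (\<Sum>i\<in>Basis. \<Sum>j\<in>Basis. \<bar>(x \<bullet> i) * ((x \<bullet> j) * (B s i j - B t i j))\<bar>)"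
      by (rule order_trans[OF sum_abs sum_mono[OF sum_abs]])
    also have "\<dots> \<le> \<delta> s"
      unfolding \<delta>_def
    proof (intro sum_mono)
      fix i j :: 'e assume "i \<in> Basis" "j \<in> Basis"
      then have "\<bar>x \<bullet> i\<bar> \<le> 1" "\<bar>x \<bullet> j\<bar> \<le> 1" using x(1) Basis_le_norm by metis+
      then have "\<bar>x \<bullet> i\<bar> * (\<bar>x \<bullet> j\<bar> * \<bar>B s i j - B t i j\<bar>) \<le> 1 * (1 * \<bar>B s i j - B t i j\<bar>)"
        by (intro mult_mono) auto
      then show "\<bar>(x \<bullet> i) * ((x \<bullet> j) * (B s i j - B t i j))\<bar> \<le> \<bar>B s i j - B t i j\<bar>"
        by (simp add: abs_mult)
    qed
    finally have "m \<le> B s x x" using s(2) w0(2)[OF x(1)] by (simp add: m_def)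
    then have "m * (norm w)\<^sup>2 \<le> (norm w)\<^sup>2 * B s x x"
      using mult_left_mono[of m "B s x x" "(norm w)\<^sup>2"] by (simp add: mult.commute)
    also have "\<dots> = B s w w"
      by (subst (2 3) x(2)) (simp add: bilinear_lmul[OF bil[OF s(1)]] bilinear_rmul[OF bil[OF s(1)]]
          power2_eq_square)
    finally show ?thesis .
  qed
  define \<epsilon> where "\<epsilon> s = (\<Sum>b\<in>Basis. \<bar>B s (z s) b - B s (z t) b\<bar>)" for s
  have bound: "norm (z s - z t) \<le> \<epsilon> s / m" if s: "s \<in> T" "\<delta> s < m" for s
  proof (cases "z s = z t")
    case True
    then show ?thesis using m by (simp add: \<epsilon>_def sum_nonneg)
  next
    case False
    let ?d = "z s - z t"
    have "m * (norm ?d)\<^sup>2 \<le> B s ?d ?d" using lower[OF s] .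
    also have "\<dots> = (\<Sum>b\<in>Basis. (?d \<bullet> b) * (B s (z s) b - B s (z t) b))"
      using bil[OF s(1)] linear_eq_sum_Basis[of "B s ?d" ?d] bilinear_lsub[OF bil[OF s(1)], of "z s" "z t"]
      by (simp add: bilinear_def)
    also have "\<dots> \<le> (\<Sum>b\<in>Basis. norm ?d * \<bar>B s (z s) b - B s (z t) b\<bar>)"
    proof (intro sum_mono)
      fix b :: 'e assume "b \<in> Basis"
      then have "\<bar>?d \<bullet> b\<bar> \<le> norm ?d" by (rule Basis_le_norm)
      then have "\<bar>?d \<bullet> b\<bar> * \<bar>B s (z s) b - B s (z t) b\<bar> \<le> norm ?d * \<bar>B s (z s) b - B s (z t) b\<bar>"
        by (rule mult_right_mono) simp
      then show "(?d \<bullet> b) * (B s (z s) b - B s (z t) b) \<le> norm ?d * \<bar>B s (z s) b - B s (z t) b\<bar>"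
        using order_trans[OF abs_ge_self[of "(?d \<bullet> b) * (B s (z s) b - B s (z t) b)"]]
        by (simp add: abs_mult)
    qed
    finally have "norm ?d * (m * norm ?d) \<le> norm ?d * \<epsilon> s"
      by (simp add: \<epsilon>_def sum_distrib_left power2_eq_square mult_ac)
    then have "m * norm ?d \<le> \<epsilon> s" using False by simp
    then show ?thesis using m by (simp add: field_simps)
  qed
  \<comment> \<open>With i = z t the two limits show that both terms of each residual in \<epsilon>
    converge to B t (z t) b.\<close>
  have lim: "((\<lambda>s. B s i j) \<longlongrightarrow> B t i j) (at t within T)" "((\<lambda>s. B s (z s) j) \<longlongrightarrow> B t (z t) j) (at t within T)"
    for i j using cont sol t by (auto simp: continuous_on_def)
  have "(\<delta> \<longlongrightarrow> (\<Sum>i\<in>Basis. \<Sum>j\<in>Basis. \<bar>B t i j - B t i j\<bar>)) (at t within T)"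
    unfolding \<delta>_def by (intro tendsto_intros lim)
  then have "eventually (\<lambda>s. \<delta> s < m) (at t within T)"
    using m by (intro order_tendstoD(2)) auto
  then have "eventually (\<lambda>s. norm (z s - z t) \<le> \<epsilon> s / m) (at t within T)"
    using eventually_at_topological bound by (smt (verit) eventually_at_topological)
  moreover have "((\<lambda>s. \<epsilon> s / m) \<longlongrightarrow> (\<Sum>b\<in>Basis. \<bar>B t (z t) b - B t (z t) b\<bar>) / m) (at t within T)"
    unfolding \<epsilon>_def using m by (intro tendsto_intros lim) auto
  then have "((\<lambda>s. \<epsilon> s / m) \<longlongrightarrow> 0) (at t within T)" by simp
  ultimately have "((\<lambda>s. z s - z t) \<longlongrightarrow> 0) (at t within T)"
    by (rule Lim_null_comparison)
  then show "(z \<longlongrightarrow> z t) (at t within T)" by (simp add: LIM_zero_iff)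
qed

section \<open>Symmetry of second derivatives\<close>

text \<open>Two applications of the mean value theorem: in direction u to the increment of f along
  v, and in direction v to the derivative along u. The second difference is symmetric in u and v
  while the right-hand side is not, and that is the source of the symmetry of mixed
  derivatives.\<close>

lemma second_difference_mvt:
  fixes f :: "'e::euclidean_space \<Rightarrow> real"
  assumes f: "smooth_on S f" "open S" and h: "h > 0"
    and S: "\<And>s t. s \<in> {0..h} \<Longrightarrow> t \<in> {0..h} \<Longrightarrow> x + s *\<^sub>R u + t *\<^sub>R v \<in> S"
  shows "\<exists>s\<in>{0..h}. \<exists>t\<in>{0..h}.
    f (x + h *\<^sub>R u + h *\<^sub>R v) - f (x + h *\<^sub>R u) - f (x + h *\<^sub>R v) + f x =
    h\<^sup>2 * frechet_derivative (\<lambda>y. frechet_derivative f (at y) u) (at (x + s *\<^sub>R u + t *\<^sub>R v)) v"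
proof -
  have along: "((\<lambda>s. g (y + s *\<^sub>R w)) has_real_derivative frechet_derivative g (at (y + s *\<^sub>R w)) w) (at s)"
    if g: "smooth_on S g" "y + s *\<^sub>R w \<in> S" for g :: "'e \<Rightarrow> real" and y w s
  proof -
    have D: "(g has_derivative frechet_derivative g (at (y + s *\<^sub>R w))) (at (y + s *\<^sub>R w))"
      using smooth_on_has_derivative[OF g(1) f(2) g(2)] .
    have "((\<lambda>s. y + s *\<^sub>R w) has_derivative (\<lambda>c. c *\<^sub>R w)) (at s)"
      by (auto intro!: derivative_eq_intros)
    from has_derivative_compose[OF this D]
    show ?thesis
      by (simp add: has_field_derivative_def linear_scale[OF has_derivative_linear[OF D]] mult_commute_abs)
  qed
  let ?g = "\<lambda>s. f (x + s *\<^sub>R u + h *\<^sub>R v) - f (x + s *\<^sub>R u)"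
  let ?D = "\<lambda>y. frechet_derivative f (at y) u"
  have "(?g has_real_derivative ?D (x + s *\<^sub>R u + h *\<^sub>R v) - ?D (x + s *\<^sub>R u)) (at s)"
    if "0 \<le> s" "s \<le> h" for s
    using along[OF f(1), of "x + h *\<^sub>R v" s u] along[OF f(1), of x s u] S[of s h] S[of s 0] that h
    by (intro DERIV_diff) (auto simp: add_ac)
  from MVT2[OF h this] obtain s where s: "0 < s" "s < h"
    "?g h - ?g 0 = h * (?D (x + s *\<^sub>R u + h *\<^sub>R v) - ?D (x + s *\<^sub>R u))" by auto
  have "((\<lambda>t. ?D (x + s *\<^sub>R u + t *\<^sub>R v)) has_real_derivative
      frechet_derivative ?D (at (x + s *\<^sub>R u + t *\<^sub>R v)) v) (at t)" if "0 \<le> t" "t \<le> h" for t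
    using along[OF smooth_on_frechet_derivative[OF f(1)], of "x + s *\<^sub>R u" t v] S[of s t] that s by auto
  from MVT2[OF h this] obtain t where t: "0 < t" "t < h"
    "?D (x + s *\<^sub>R u + h *\<^sub>R v) - ?D (x + s *\<^sub>R u) = h * frechet_derivative ?D (at (x + s *\<^sub>R u + t *\<^sub>R v)) v"
    by auto
  show ?thesis
    using s t by (intro bexI[of _ s] bexI[of _ t]) (auto simp: power2_eq_square)
qed

text \<open>If the mixed derivatives differed by e at x, then by continuity neither would move by
  e/2 near x, so their ranges would stay disjoint there. The second difference of a small
  parallelogram forces a value of one to equal a value of the other.\<close>

lemma symmetric_second_derivative_real:
  fixes f :: "'e::euclidean_space \<Rightarrow> real"
  assumes f: "smooth_on S f" "open S" and x: "x \<in> S"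
  shows "frechet_derivative (\<lambda>y. frechet_derivative f (at y) u) (at x) v =
         frechet_derivative (\<lambda>y. frechet_derivative f (at y) v) (at x) u"
proof (rule ccontr)
  define D where "D u v y = frechet_derivative (\<lambda>y. frechet_derivative f (at y) u) (at y) v" for u v y
  assume "\<not> ?thesis"
  then have ne: "D u v x \<noteq> D v u x" by (simp add: D_def)
  define e where "e = \<bar>D u v x - D v u x\<bar>"
  have contD: "isCont (D u v) x" "isCont (D v u) x" unfolding D_def
    using f x by (metis smooth_on_frechet_derivative smooth_on_imp_continuous_on continuous_on_eq_continuous_at)+
  have "e > 0" using ne by (simp add: e_def)
  then have "eventually (\<lambda>y. dist (D u v y) (D u v x) < e / 2) (nhds x)"
      "eventually (\<lambda>y. dist (D v u y) (D v u x) < e / 2) (nhds x)"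
    using contD[unfolded continuous_at tendsto_at_iff_tendsto_nhds, THEN tendstoD, of "e / 2"]
    by simp_all
  moreover have "eventually (\<lambda>y. y \<in> S) (nhds x)" using f(2) x by (rule eventually_nhds_in_open)
  ultimately have "eventually (\<lambda>y. y \<in> S \<and> dist (D u v y) (D u v x) < e / 2 \<and> dist (D v u y) (D v u x) < e / 2) (nhds x)"
    by eventually_elim simp
  then obtain r where r: "r > 0" "\<And>y. dist y x < r \<Longrightarrow> y \<in> S"
    "\<And>y. dist y x < r \<Longrightarrow> dist (D u v y) (D u v x) < e / 2"
    "\<And>y. dist y x < r \<Longrightarrow> dist (D v u y) (D v u x) < e / 2"
    unfolding eventually_nhds_metric by blast
  \<comment> \<open>Keeps the parallelogram with sides h u and h v inside the ball of radius r; the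
    summand 1 covers u = v = 0 and makes the estimate strict.\<close>
  define h where "h = r / (norm u + norm v + 1)"
  have npos: "norm u + norm v + 1 > 0" by (simp add: add_nonneg_pos)
  have h: "h > 0" using r npos by (simp add: h_def)
  have near: "dist (x + s *\<^sub>R u + t *\<^sub>R v) x < r" if "s \<in> {0..h}" "t \<in> {0..h}" for s t
  proof -
    have "dist (x + s *\<^sub>R u + t *\<^sub>R v) x = norm (s *\<^sub>R u + t *\<^sub>R v)" by (simp add: dist_norm)
    also have "\<dots> \<le> s * norm u + t * norm v"
      using norm_triangle_ineq[of "s *\<^sub>R u" "t *\<^sub>R v"] that by simp
    also have "\<dots> \<le> h * norm u + h * norm v" using that by (intro add_mono mult_right_mono) auto
    also have "\<dots> < h * (norm u + norm v + 1)" using h by (simp add: algebra_simps)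
    also have "\<dots> = r" using npos by (simp add: h_def)
    finally show ?thesis .
  qed
  have swap: "x + s *\<^sub>R v + t *\<^sub>R u = x + t *\<^sub>R u + s *\<^sub>R v" for s t by simp
  obtain s t where st: "s \<in> {0..h}" "t \<in> {0..h}"
    "f (x + h *\<^sub>R u + h *\<^sub>R v) - f (x + h *\<^sub>R u) - f (x + h *\<^sub>R v) + f x = h\<^sup>2 * D u v (x + s *\<^sub>R u + t *\<^sub>R v)"
    using second_difference_mvt[OF f h, of x u v] near r(2) unfolding D_def by blast
  obtain s' t' where st': "s' \<in> {0..h}" "t' \<in> {0..h}"
    "f (x + h *\<^sub>R v + h *\<^sub>R u) - f (x + h *\<^sub>R v) - f (x + h *\<^sub>R u) + f x = h\<^sup>2 * D v u (x + s' *\<^sub>R v + t' *\<^sub>R u)"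
    using second_difference_mvt[OF f h, of x v u] near r(2) unfolding D_def swap by blast
  have "h\<^sup>2 * D u v (x + s *\<^sub>R u + t *\<^sub>R v) = h\<^sup>2 * D v u (x + t' *\<^sub>R u + s' *\<^sub>R v)"
    using st(3) st'(3) unfolding swap by linarith
  then have "D u v (x + s *\<^sub>R u + t *\<^sub>R v) = D v u (x + t' *\<^sub>R u + s' *\<^sub>R v)" using h by simp
  then show False
    using r(3)[OF near[OF st(1,2)]] r(4)[OF near[OF st'(2,1)]] e_def
    unfolding dist_real_def by linarith
qed

lemma symmetric_second_derivative:
  fixes f :: "'e::euclidean_space \<Rightarrow> 'f::euclidean_space"
  assumes f: "smooth_on S f" "open S" and x: "x \<in> S"
  shows "frechet_derivative (\<lambda>y. frechet_derivative f (at y) u) (at x) v =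
         frechet_derivative (\<lambda>y. frechet_derivative f (at y) v) (at x) u"
proof (rule euclidean_eqI)
  fix b :: 'f
  have D: "frechet_derivative (\<lambda>z. g z \<bullet> b) (at y) w = frechet_derivative g (at y) w \<bullet> b"
    if "smooth_on S g" "y \<in> S" for g :: "'e \<Rightarrow> 'f" and y w
    using frechet_derivative_at[OF bounded_linear.has_derivative[OF bounded_linear_inner_left
          smooth_on_has_derivative[OF that(1) f(2) that(2)]], of b] by metis
  have "smooth_on S (\<lambda>y. f y \<bullet> b)" by (intro smooth_on_inner f smooth_on_const)
  note this[THEN symmetric_second_derivative_real[OF _ f(2) x], of u v]
  moreover have "frechet_derivative (\<lambda>y. frechet_derivative (\<lambda>y. f y \<bullet> b) (at y) u) (at x) v
     = frechet_derivative (\<lambda>y. frechet_derivative f (at y) u) (at x) v \<bullet> b" for u v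
  proof -
    have "((\<lambda>y. frechet_derivative f (at y) u \<bullet> b) has_derivative
        (\<lambda>v. frechet_derivative (\<lambda>y. frechet_derivative f (at y) u) (at x) v \<bullet> b)) (at x)"
      by (intro bounded_linear.has_derivative[OF bounded_linear_inner_left]
          smooth_on_has_derivative[OF smooth_on_frechet_derivative[OF f(1)] f(2) x])
    then have "((\<lambda>y. frechet_derivative (\<lambda>y. f y \<bullet> b) (at y) u) has_derivative
        (\<lambda>v. frechet_derivative (\<lambda>y. frechet_derivative f (at y) u) (at x) v \<bullet> b)) (at x)"
      by (rule has_derivative_transform_within_open[OF _ f(2) x]) (simp add: D f)
    from frechet_derivative_at[OF this] show ?thesis by metis
  qed
  ultimately show "frechet_derivative (\<lambda>y. frechet_derivative f (at y) u) (at x) v \<bullet> b =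
         frechet_derivative (\<lambda>y. frechet_derivative f (at y) v) (at x) u \<bullet> b" by simp
qed

section \<open>Linear differential equations\<close>

text \<open>The integral operator is a contraction in the sup norm with constant M (b - a), at most
  1/2, so Banach's fixed point theorem yields a solution for any initial value.\<close>

lemma linear_ode_short_interval:
  fixes L :: "real \<Rightarrow> 'e::euclidean_space \<Rightarrow>\<^sub>L 'e"
  assumes ab: "a \<le> b" and L: "continuous_on {a..b} L"
    and M: "\<And>t. t \<in> {a..b} \<Longrightarrow> norm (L t) \<le> M" "M * (b - a) \<le> 1 / 2"
  shows "\<exists>v. v a = v0 \<and> (\<forall>t\<in>{a..b}. (v has_vector_derivative L t (v t)) (at t within {a..b}))"
proof -
  have M0: "M \<ge> 0" using order_trans[OF norm_ge_zero M(1)[of a]] ab by simp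
  define I where "I f u = v0 + integral {a..u} (\<lambda>s. blinfun_apply (L s) (apply_bcontfun f s))" for f u
  have contf: "continuous_on {a..b} (\<lambda>s. blinfun_apply (L s) (apply_bcontfun f s))" for f
    by (intro continuous_intros L continuous_on_subset[OF continuous_on_apply_bcontfun]) auto
  have contI: "continuous_on {a..b} (I f)" for f
    unfolding I_def
    by (intro continuous_intros indefinite_integral_continuous_1 integrable_continuous_real contf)
  \<comment> \<open>The complete space at hand consists of bounded continuous functions on the whole
    line; clamping extends a function on the interval by its end values.\<close>
  have clampI: "(\<lambda>t. I f (clamp a b t)) \<in> bcontfun" for f
  proof -
    have "bounded (I f ` cbox a b)"
      using compact_imp_bounded[OF compact_continuous_image[OF contI compact_Icc]] by (simp add: cbox_interval)
    then show ?thesis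
      using clamp_continuous_on[of a b "I f" UNIV] contI clamp_bounded[of "I f" a b]
      by (auto simp: bcontfun_def cbox_interval)
  qed
  define T where "T f = Bcontfun (\<lambda>t. I f (clamp a b t))" for f
  have T: "apply_bcontfun (T f) t = I f (clamp a b t)" for f t
    by (simp add: T_def Bcontfun_inverse[OF clampI])
  have "dist (T f) (T g) \<le> 1 / 2 * dist f g" for f g
  proof (rule dist_bound)
    fix t :: real
    define u where "u = clamp a b t"
    have u: "a \<le> u" "u \<le> b" using clamp_in_interval[of a b t] ab by (auto simp: u_def cbox_interval)
    have int: "(\<lambda>s. blinfun_apply (L s) (apply_bcontfun f s)) integrable_on {a..u}" for f
      by (intro integrable_continuous_real continuous_on_subset[OF contf]) (use u in auto)
    have hi: "((\<lambda>s. blinfun_apply (L s) (apply_bcontfun f s) - blinfun_apply (L s) (apply_bcontfun g s))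
        has_integral I f u - I g u) {a..u}"
      using has_integral_diff[OF integrable_integral[OF int] integrable_integral[OF int]]
      by (simp add: I_def)
    have "norm (I f u - I g u) \<le> (M * dist f g) * measure lborel {a..u}"
    proof (rule has_integral_bound_real[OF _ finite.emptyI hi])
      fix s assume s: "s \<in> {a..u} - {}"
      have "norm (L s (f s) - L s (g s)) \<le> norm (L s) * dist (f s) (g s)"
        by (metis blinfun.diff_right dist_norm norm_blinfun)
      also have "\<dots> \<le> M * dist f g"
        using s u M0 by (intro mult_mono M dist_bounded) auto
      finally show "norm (L s (f s) - L s (g s)) \<le> M * dist f g" .
    qed (simp add: M0)
    also have "\<dots> \<le> (M * dist f g) * (b - a)"
      using u M0 by (intro mult_left_mono) auto
    also have "\<dots> \<le> 1 / 2 * dist f g"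
      using mult_right_mono[OF M(2), of "dist f g"] by (simp add: mult_ac)
    finally show "dist (T f t) (T g t) \<le> 1 / 2 * dist f g"
      by (simp add: T dist_norm u_def)
  qed
  then obtain f where f: "T f = f" using banach_fix_type[of "1 / 2" T] by auto
  have fI: "apply_bcontfun f t = I f t" if "t \<in> {a..b}" for t
    using T[of f t] that clamp_cancel_cbox[of t a b] by (simp add: f cbox_interval)
  have "(apply_bcontfun f has_vector_derivative L t (f t)) (at t within {a..b})" if t: "t \<in> {a..b}" for t
  proof -
    have "(I f has_vector_derivative L t (f t)) (at t within {a..b})"
      unfolding I_def using has_vector_derivative_add[OF has_vector_derivative_const
          integral_has_vector_derivative[OF contf t]] by simp
    then show ?thesis by (rule has_vector_derivative_transform[OF t, rotated]) (simp add: fI)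
  qed
  moreover have "apply_bcontfun f a = v0" using fI[of a] ab by (simp add: I_def)
  ultimately show ?thesis by blast
qed

lemma linear_ode_local:
  fixes L :: "real \<Rightarrow> 'e::euclidean_space \<Rightarrow> 'e"
  assumes lin: "\<And>t. t \<in> {a..b} \<Longrightarrow> linear (L t)" and cont: "\<And>w. continuous_on {a..b} (\<lambda>t. L t w)"
  obtains d where "d > 0"
    "\<And>y z v0. a \<le> y \<Longrightarrow> y \<le> z \<Longrightarrow> z \<le> b \<Longrightarrow> z - y < d \<Longrightarrow>
       \<exists>v. v y = v0 \<and> (\<forall>t\<in>{y..z}. (v has_vector_derivative L t (v t)) (at t within {y..z}))"
proof -
  \<comment> \<open>As operators the coefficients have a norm, and continuity in the operator norm
    follows from continuity at each vector in finite dimension. Compactness then gives one bound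
    M.\<close>
  define B where "B t = Blinfun (L t)" for t
  have B: "blinfun_apply (B t) = L t" if "t \<in> {a..b}" for t
    using lin[OF that] by (simp add: B_def bounded_linear_Blinfun_apply linear_conv_bounded_linear)
  have contB: "continuous_on {a..b} B"
    by (rule continuous_on_blinfun_componentwise, rule continuous_on_eq[OF cont]) (simp add: B)
  obtain M where M: "M > 0" "\<And>t. t \<in> {a..b} \<Longrightarrow> norm (B t) \<le> M"
    using compact_imp_bounded[OF compact_continuous_image[OF contB compact_Icc]]
    by (auto simp: bounded_pos)
  show thesis
  proof
    \<comment> \<open>At this length M (z - y) is at most 1/2, for every subinterval and every
      initial value alike.\<close>
    show "1 / (2 * M) > 0" using M by simp
    fix y z v0 assume yz: "a \<le> y" "y \<le> z" "z \<le> b" "z - y < 1 / (2 * M)"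
    have "M * (z - y) \<le> 1 / 2" using yz(4) M(1) by (simp add: field_simps)
    then have "\<exists>v. v y = v0 \<and> (\<forall>t\<in>{y..z}. (v has_vector_derivative B t (v t)) (at t within {y..z}))"
      using yz M(2) by (intro linear_ode_short_interval[where M=M] continuous_on_subset[OF contB]) auto
    then show "\<exists>v. v y = v0 \<and> (\<forall>t\<in>{y..z}. (v has_vector_derivative L t (v t)) (at t within {y..z}))"
      using yz B by auto
  qed
qed

section \<open>Charts and tangent spaces\<close>

locale atlas_manifold =
  fixes A :: "('a::{t2_space, second_countable_topology}, 'e::euclidean_space) chart set"
  assumes atlas: "smooth_atlas A"
begin

abbreviation dtrans :: "('a, 'e) chart \<Rightarrow> ('a, 'e) chart \<Rightarrow> 'a \<Rightarrow> 'e \<Rightarrow> 'e" where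
  "dtrans \<kappa> \<mu> p \<equiv> frechet_derivative (transition \<kappa> \<mu>) (at (snd \<kappa> p))"

lemma chart_around: obtains \<kappa> where "\<kappa> \<in> A" "p \<in> fst \<kappa>"
  using atlas unfolding smooth_atlas_def by blast

lemma is_chart: "\<kappa> \<in> A \<Longrightarrow> is_chart \<kappa>"
  using atlas unfolding smooth_atlas_def by blast

lemma open_domain: "\<kappa> \<in> A \<Longrightarrow> open (fst \<kappa>)"
  and open_chart_image: "\<kappa> \<in> A \<Longrightarrow> open (chart_image \<kappa>)"
  and continuous_on_chart_inv: "\<kappa> \<in> A \<Longrightarrow> continuous_on (chart_image \<kappa>) (chart_inv \<kappa>)"
  and chart_inv_left: "\<kappa> \<in> A \<Longrightarrow> p \<in> fst \<kappa> \<Longrightarrow> chart_inv \<kappa> (snd \<kappa> p) = p"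
  using is_chart unfolding is_chart_def homeomorphism_def by blast+

lemma chart_inv_right: "x \<in> chart_image \<kappa> \<Longrightarrow> snd \<kappa> (chart_inv \<kappa> x) = x"
  and chart_inv_in: "x \<in> chart_image \<kappa> \<Longrightarrow> chart_inv \<kappa> x \<in> fst \<kappa>"
  by (auto simp: f_inv_into_f inv_into_into)

lemma open_chart_image_Int:
  assumes "\<kappa> \<in> A" "open U"
  shows "open (snd \<kappa> ` (fst \<kappa> \<inter> U))"
proof -
  have "snd \<kappa> ` (fst \<kappa> \<inter> U) = chart_image \<kappa> \<inter> chart_inv \<kappa> -` U"
    using chart_inv_left[OF assms(1)] by fastforce
  then show ?thesis
    using continuous_open_preimage[OF continuous_on_chart_inv open_chart_image assms(2)] assms(1) by simp
qed

lemma open_overlap: "\<kappa> \<in> A \<Longrightarrow> \<mu> \<in> A \<Longrightarrow> open (snd \<kappa> ` (fst \<kappa> \<inter> fst \<mu>))"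
  by (intro open_chart_image_Int open_domain)

lemma smooth_transition:
  "\<kappa> \<in> A \<Longrightarrow> \<mu> \<in> A \<Longrightarrow> smooth_on (snd \<kappa> ` (fst \<kappa> \<inter> fst \<mu>)) (transition \<kappa> \<mu>)"
  using atlas unfolding smooth_atlas_def by blast

lemma transition_chart: "\<kappa> \<in> A \<Longrightarrow> p \<in> fst \<kappa> \<Longrightarrow> transition \<kappa> \<mu> (snd \<kappa> p) = snd \<mu> p"
  by (simp add: transition_def chart_inv_left)

lemma has_derivative_transition:
  assumes "\<kappa> \<in> A" "\<mu> \<in> A" "p \<in> fst \<kappa>" "p \<in> fst \<mu>"
  shows "(transition \<kappa> \<mu> has_derivative dtrans \<kappa> \<mu> p) (at (snd \<kappa> p))"
  using assms by (intro smooth_on_has_derivative[OF smooth_transition open_overlap]) auto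

lemma linear_dtrans:
  "\<kappa> \<in> A \<Longrightarrow> \<mu> \<in> A \<Longrightarrow> p \<in> fst \<kappa> \<Longrightarrow> p \<in> fst \<mu> \<Longrightarrow> linear (dtrans \<kappa> \<mu> p)"
  using has_derivative_linear[OF has_derivative_transition] .

text \<open>The cocycle identity, from the chain rule. The two transition maps compose to the third
  only over the common domain of the three charts, an open set containing p.\<close>

lemma dtrans_compose:
  assumes "\<kappa> \<in> A" "\<mu> \<in> A" "\<nu> \<in> A" "p \<in> fst \<kappa>" "p \<in> fst \<mu>" "p \<in> fst \<nu>"
  shows "dtrans \<mu> \<nu> p (dtrans \<kappa> \<mu> p u) = dtrans \<kappa> \<nu> p u"
proof -
  have "(transition \<mu> \<nu> has_derivative dtrans \<mu> \<nu> p) (at (transition \<kappa> \<mu> (snd \<kappa> p)))"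
    using has_derivative_transition[of \<mu> \<nu> p] assms by (simp add: transition_chart)
  from has_derivative_compose[OF has_derivative_transition this]
  have "((\<lambda>x. transition \<mu> \<nu> (transition \<kappa> \<mu> x)) has_derivative (\<lambda>u. dtrans \<mu> \<nu> p (dtrans \<kappa> \<mu> p u)))
      (at (snd \<kappa> p))" using assms by simp
  then have "(transition \<kappa> \<nu> has_derivative (\<lambda>u. dtrans \<mu> \<nu> p (dtrans \<kappa> \<mu> p u))) (at (snd \<kappa> p))"
    by (rule has_derivative_transform_within_open[OF _ open_chart_image_Int[of \<kappa> "fst \<mu> \<inter> fst \<nu>"]])
      (use assms in \<open>auto simp: transition_chart open_domain open_Int\<close>)
  from has_derivative_unique[OF this has_derivative_transition] show ?thesis
    using assms by metis
qed

lemma dtrans_id: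
  assumes "\<kappa> \<in> A" "p \<in> fst \<kappa>"
  shows "dtrans \<kappa> \<kappa> p u = u"
proof -
  have "(transition \<kappa> \<kappa> has_derivative (\<lambda>u. u)) (at (snd \<kappa> p))"
    by (rule has_derivative_transform_within_open[OF has_derivative_ident open_chart_image[OF assms(1)]])
      (use assms in \<open>auto simp: transition_chart\<close>)
  from has_derivative_unique[OF this has_derivative_transition] show ?thesis
    using assms by metis
qed

lemma tangent_space_dtrans:
  "v \<in> tangent_space A p \<Longrightarrow> \<kappa> \<in> A \<Longrightarrow> \<mu> \<in> A \<Longrightarrow> p \<in> fst \<kappa> \<Longrightarrow> p \<in> fst \<mu> \<Longrightarrow> v \<mu> = dtrans \<kappa> \<mu> p (v \<kappa>)"
  unfolding tangent_space_def by blast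

lemma tangent_space_eq_0: "v \<in> tangent_space A p \<Longrightarrow> \<not> (\<kappa> \<in> A \<and> p \<in> fst \<kappa>) \<Longrightarrow> v \<kappa> = 0"
  unfolding tangent_space_def by blast

lemma tangent_spaceI:
  assumes "\<And>\<kappa> \<mu>. \<kappa> \<in> A \<Longrightarrow> \<mu> \<in> A \<Longrightarrow> p \<in> fst \<kappa> \<Longrightarrow> p \<in> fst \<mu> \<Longrightarrow> v \<mu> = dtrans \<kappa> \<mu> p (v \<kappa>)"
    and "\<And>\<kappa>. \<not> (\<kappa> \<in> A \<and> p \<in> fst \<kappa>) \<Longrightarrow> v \<kappa> = 0"
  shows "v \<in> tangent_space A p"
  using assms unfolding tangent_space_def by blast

lemma coord_vec_apply: "\<mu> \<in> A \<Longrightarrow> p \<in> fst \<mu> \<Longrightarrow> coord_vec A \<kappa> p u \<mu> = dtrans \<kappa> \<mu> p u"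
  by (simp add: coord_vec_def)

lemma coord_vec_apply_same: "\<kappa> \<in> A \<Longrightarrow> p \<in> fst \<kappa> \<Longrightarrow> coord_vec A \<kappa> p u \<kappa> = u"
  by (simp add: coord_vec_def dtrans_id)

lemma coord_vec_in_tangent_space:
  "\<kappa> \<in> A \<Longrightarrow> p \<in> fst \<kappa> \<Longrightarrow> coord_vec A \<kappa> p u \<in> tangent_space A p"
  by (rule tangent_spaceI) (simp_all add: coord_vec_apply dtrans_compose, auto simp: coord_vec_def)

text \<open>Together with \<open>coord_vec_apply_same\<close> this identifies the tangent space with
  the coordinate space of any chart around the point.\<close>

lemma coord_vec_of_coord:
  assumes "\<kappa> \<in> A" "p \<in> fst \<kappa>" "v \<in> tangent_space A p"
  shows "coord_vec A \<kappa> p (v \<kappa>) = v"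
proof
  show "coord_vec A \<kappa> p (v \<kappa>) \<mu> = v \<mu>" for \<mu>
    using tangent_space_dtrans[OF assms(3,1), of \<mu>] tangent_space_eq_0[OF assms(3), of \<mu>] assms(2)
    by (auto simp: coord_vec_def)
qed

lemma subspace_tangent_space: "subspace (tangent_space A p)"
  unfolding subspace_def
proof (intro conjI ballI allI)
  show "0 \<in> tangent_space A p"
    by (rule tangent_spaceI) (simp_all add: linear_0[OF linear_dtrans])
  fix v w :: "('a, 'e) tvec" and r :: real
  assume v: "v \<in> tangent_space A p"
  then have "(r *\<^sub>R v) \<mu> = dtrans \<kappa> \<mu> p ((r *\<^sub>R v) \<kappa>)" if "\<kappa> \<in> A" "\<mu> \<in> A" "p \<in> fst \<kappa>" "p \<in> fst \<mu>" for \<kappa> \<mu>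
    using tangent_space_dtrans[OF v that] linear_scale[OF linear_dtrans[OF that]]
    by (simp add: scaleR_fun_def)
  then show "r *\<^sub>R v \<in> tangent_space A p"
    by (rule tangent_spaceI) (simp_all add: tangent_space_eq_0[OF v] scaleR_fun_def)
  assume w: "w \<in> tangent_space A p"
  then have "(v + w) \<mu> = dtrans \<kappa> \<mu> p ((v + w) \<kappa>)" if "\<kappa> \<in> A" "\<mu> \<in> A" "p \<in> fst \<kappa>" "p \<in> fst \<mu>" for \<kappa> \<mu>
    using tangent_space_dtrans[OF v that] tangent_space_dtrans[OF w that]
      linear_add[OF linear_dtrans[OF that]]
    by simp
  then show "v + w \<in> tangent_space A p"
    by (rule tangent_spaceI) (simp_all add: tangent_space_eq_0[OF v] tangent_space_eq_0[OF w])
qed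

lemmas tangent_space_closed =
  subspace_0[OF subspace_tangent_space] subspace_add[OF subspace_tangent_space]
  subspace_diff[OF subspace_tangent_space] subspace_scale[OF subspace_tangent_space]

lemma coord_vec_add:
  assumes "\<kappa> \<in> A" "p \<in> fst \<kappa>"
  shows "coord_vec A \<kappa> p (u + v) = coord_vec A \<kappa> p u + coord_vec A \<kappa> p v"
  using linear_add[OF linear_dtrans[OF assms(1) _ assms(2)]] by (auto simp: coord_vec_def fun_eq_iff)

lemma coord_vec_scale:
  assumes "\<kappa> \<in> A" "p \<in> fst \<kappa>"
  shows "coord_vec A \<kappa> p (r *\<^sub>R u) = r *\<^sub>R coord_vec A \<kappa> p u"
  using linear_scale[OF linear_dtrans[OF assms(1) _ assms(2)]]
  by (auto simp: coord_vec_def fun_eq_iff scaleR_fun_def)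

lemma coord_vec_eq_0_iff:
  assumes "\<kappa> \<in> A" "p \<in> fst \<kappa>"
  shows "coord_vec A \<kappa> p u = 0 \<longleftrightarrow> u = 0"
  using coord_vec_scale[OF assms, of 0] coord_vec_apply_same[OF assms, of u] by auto

end

section \<open>Riemannian metrics and Christoffel symbols\<close>

lemma has_vector_derivative_compose_frechet:
  assumes "(f has_derivative f') (at (c t))" "(c has_vector_derivative c') (at t)"
  shows "((\<lambda>s. f (c s)) has_vector_derivative f' c') (at t)"
  using has_derivative_compose[OF assms(2)[unfolded has_vector_derivative_def] assms(1)]
  by (simp add: has_vector_derivative_def linear_scale[OF has_derivative_linear[OF assms(1)]])

locale riemannian_manifold = atlas_manifold A
  for A :: "('a::{t2_space, second_countable_topology}, 'e::euclidean_space) chart set" +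
  fixes h :: "('a, 'e) metric"
  assumes metric: "riemannian_metric A h"
begin

section \<open>Algebra of the metric on tangent spaces\<close>

lemma h_commute: "u \<in> tangent_space A p \<Longrightarrow> v \<in> tangent_space A p \<Longrightarrow> h p u v = h p v u"
  and h_lincomb: "u \<in> tangent_space A p \<Longrightarrow> v \<in> tangent_space A p \<Longrightarrow> w \<in> tangent_space A p \<Longrightarrow>
    h p (r *\<^sub>R u + s *\<^sub>R v) w = r * h p u w + s * h p v w"
  and h_pos: "v \<in> tangent_space A p \<Longrightarrow> v \<noteq> 0 \<Longrightarrow> h p v v > 0"
  using metric unfolding riemannian_metric_def by blast+

lemma h_add_left: "u \<in> tangent_space A p \<Longrightarrow> v \<in> tangent_space A p \<Longrightarrow> w \<in> tangent_space A p \<Longrightarrow>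
    h p (u + v) w = h p u w + h p v w"
  using h_lincomb[of u p v w 1 1] by simp

lemma h_scale_left: "u \<in> tangent_space A p \<Longrightarrow> w \<in> tangent_space A p \<Longrightarrow> h p (r *\<^sub>R u) w = r * h p u w"
  using h_lincomb[of u p u w r 0] by simp

lemma h_diff_left: "u \<in> tangent_space A p \<Longrightarrow> v \<in> tangent_space A p \<Longrightarrow> w \<in> tangent_space A p \<Longrightarrow>
    h p (u - v) w = h p u w - h p v w"
  using h_lincomb[of u p v w 1 "-1"] by simp

lemma h_add_right: "u \<in> tangent_space A p \<Longrightarrow> v \<in> tangent_space A p \<Longrightarrow> w \<in> tangent_space A p \<Longrightarrow>
    h p w (u + v) = h p w u + h p w v"
  using h_add_left h_commute tangent_space_closed by metis

lemma h_diff_right: "u \<in> tangent_space A p \<Longrightarrow> v \<in> tangent_space A p \<Longrightarrow> w \<in> tangent_space A p \<Longrightarrow>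
    h p w (u - v) = h p w u - h p w v"
  using h_diff_left h_commute tangent_space_closed by metis

lemma h_scale_right: "u \<in> tangent_space A p \<Longrightarrow> w \<in> tangent_space A p \<Longrightarrow> h p w (r *\<^sub>R u) = r * h p w u"
  using h_scale_left h_commute tangent_space_closed by metis

lemma h_eq_0_iff: "v \<in> tangent_space A p \<Longrightarrow> h p v v = 0 \<longleftrightarrow> v = 0"
  using h_pos[of v p] h_scale_left[of v p v 0] by (cases "v = 0") auto

lemma h_nonneg: "v \<in> tangent_space A p \<Longrightarrow> h p v v \<ge> 0"
  using h_pos[of v p] h_eq_0_iff[of v p] by fastforce

section \<open>The metric in coordinates and its first derivatives\<close>

abbreviation gmet :: "('a, 'e) chart \<Rightarrow> 'e \<Rightarrow> 'e \<Rightarrow> 'e \<Rightarrow> real" where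
  "gmet \<equiv> metric_coord A h"

abbreviation dgmet :: "('a, 'e) chart \<Rightarrow> 'e \<Rightarrow> 'e \<Rightarrow> 'e \<Rightarrow> 'e \<Rightarrow> real" where
  "dgmet \<kappa> x d u v \<equiv> frechet_derivative (\<lambda>x. gmet \<kappa> x u v) (at x) d"

lemma gmet_chart: "\<kappa> \<in> A \<Longrightarrow> p \<in> fst \<kappa> \<Longrightarrow>
    gmet \<kappa> (snd \<kappa> p) u v = h p (coord_vec A \<kappa> p u) (coord_vec A \<kappa> p v)"
  by (simp add: metric_coord_def chart_inv_left Let_def)

lemma h_eq_gmet:
  "\<kappa> \<in> A \<Longrightarrow> p \<in> fst \<kappa> \<Longrightarrow> u \<in> tangent_space A p \<Longrightarrow> v \<in> tangent_space A p \<Longrightarrow>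
    h p u v = gmet \<kappa> (snd \<kappa> p) (u \<kappa>) (v \<kappa>)"
  by (simp add: gmet_chart coord_vec_of_coord)

lemma gmet_commute: "\<kappa> \<in> A \<Longrightarrow> x \<in> chart_image \<kappa> \<Longrightarrow> gmet \<kappa> x u v = gmet \<kappa> x v u"
  by (auto simp: gmet_chart intro!: h_commute coord_vec_in_tangent_space)

lemma bilinear_gmet: "\<kappa> \<in> A \<Longrightarrow> x \<in> chart_image \<kappa> \<Longrightarrow> bilinear (gmet \<kappa> x)"
  unfolding bilinear_def
  by (auto intro!: linearI simp: gmet_chart coord_vec_add coord_vec_scale h_add_left h_add_right
      h_scale_left h_scale_right coord_vec_in_tangent_space)

lemma gmet_pos: "\<kappa> \<in> A \<Longrightarrow> x \<in> chart_image \<kappa> \<Longrightarrow> w \<noteq> 0 \<Longrightarrow> gmet \<kappa> x w w > 0"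
  by (auto simp: gmet_chart coord_vec_eq_0_iff intro!: h_pos coord_vec_in_tangent_space)

lemma smooth_gmet: "\<kappa> \<in> A \<Longrightarrow> smooth_on (chart_image \<kappa>) (\<lambda>x. gmet \<kappa> x u v)"
  using metric unfolding riemannian_metric_def by blast

lemma has_derivative_gmet:
  "\<kappa> \<in> A \<Longrightarrow> x \<in> chart_image \<kappa> \<Longrightarrow> ((\<lambda>x. gmet \<kappa> x u v) has_derivative (\<lambda>d. dgmet \<kappa> x d u v)) (at x)"
  using smooth_on_has_derivative[OF smooth_gmet open_chart_image] by simp

lemma dgmet_commute:
  assumes "\<kappa> \<in> A" "x \<in> chart_image \<kappa>"
  shows "dgmet \<kappa> x d u v = dgmet \<kappa> x d v u"
proof -
  have "((\<lambda>x. gmet \<kappa> x u v) has_derivative (\<lambda>d. dgmet \<kappa> x d v u)) (at x)"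
    by (rule has_derivative_transform_within_open[OF has_derivative_gmet[OF assms]
          open_chart_image[OF assms(1)] assms(2)]) (use assms in \<open>auto simp: gmet_commute\<close>)
  from has_derivative_unique[OF this has_derivative_gmet[OF assms]] show ?thesis by metis
qed

lemma linear_dgmet_direction: "\<kappa> \<in> A \<Longrightarrow> x \<in> chart_image \<kappa> \<Longrightarrow> linear (\<lambda>d. dgmet \<kappa> x d u v)"
  using has_derivative_linear[OF has_derivative_gmet] .

text \<open>Bilinearity of the metric is an identity on the open chart image, so it can be
  differentiated; uniqueness of the derivative transfers it to \<open>dgmet\<close>.\<close>

lemma linear_dgmet:
  assumes "\<kappa> \<in> A" "x \<in> chart_image \<kappa>"
  shows "linear (\<lambda>u. dgmet \<kappa> x d u v)"
proof (rule linearI)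
  fix a b r
  have "((\<lambda>x. gmet \<kappa> x (a + b) v) has_derivative (\<lambda>d. dgmet \<kappa> x d a v + dgmet \<kappa> x d b v)) (at x)"
    by (rule has_derivative_transform_within_open[OF has_derivative_add[OF has_derivative_gmet[OF assms]
            has_derivative_gmet[OF assms]] open_chart_image[OF assms(1)] assms(2)])
      (simp add: bilinear_ladd[OF bilinear_gmet[OF assms(1)]])
  from has_derivative_unique[OF has_derivative_gmet[OF assms] this]
  show "dgmet \<kappa> x d (a + b) v = dgmet \<kappa> x d a v + dgmet \<kappa> x d b v" by metis
  have "((\<lambda>x. gmet \<kappa> x (r *\<^sub>R a) v) has_derivative (\<lambda>d. r *\<^sub>R dgmet \<kappa> x d a v)) (at x)"
    by (rule has_derivative_transform_within_open[OF has_derivative_scaleR_right[OF has_derivative_gmet[OF assms]]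
          open_chart_image[OF assms(1)] assms(2)])
      (simp add: bilinear_lmul[OF bilinear_gmet[OF assms(1)]])
  from has_derivative_unique[OF has_derivative_gmet[OF assms] this]
  show "dgmet \<kappa> x d (r *\<^sub>R a) v = r *\<^sub>R dgmet \<kappa> x d a v" by metis
qed

lemma linear_dgmet_right:
  assumes "\<kappa> \<in> A" "x \<in> chart_image \<kappa>"
  shows "linear (\<lambda>v. dgmet \<kappa> x d u v)"
proof -
  have "(\<lambda>v. dgmet \<kappa> x d u v) = (\<lambda>v. dgmet \<kappa> x d v u)"
    by (rule ext) (rule dgmet_commute[OF assms])
  then show ?thesis using linear_dgmet[OF assms] by simp
qed

lemmas dgmet_linear_simps =
  linear_add[OF linear_dgmet_direction] linear_add[OF linear_dgmet] linear_add[OF linear_dgmet_right]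
  linear_scale[OF linear_dgmet_direction] linear_scale[OF linear_dgmet] linear_scale[OF linear_dgmet_right]

text \<open>The Christoffel symbols of the first kind, that is, with the upper index lowered. Being
  an explicit expression in the derivatives of the metric, they carry all computations.\<close>

definition christoffel1 :: "('a, 'e) chart \<Rightarrow> 'e \<Rightarrow> 'e \<Rightarrow> 'e \<Rightarrow> 'e \<Rightarrow> real" where
  "christoffel1 \<kappa> x u v w = (dgmet \<kappa> x u v w + dgmet \<kappa> x v u w - dgmet \<kappa> x w u v) / 2"

lemma gmet_nondegenerate:
  assumes "\<kappa> \<in> A" "x \<in> chart_image \<kappa>" "\<And>w. gmet \<kappa> x y w = gmet \<kappa> x z w"
  shows "y = z"
proof -
  have "gmet \<kappa> x (y - z) (y - z) = 0"
    using assms(3) bilinear_lsub[OF bilinear_gmet[OF assms(1,2)]] by simp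
  then show ?thesis using gmet_pos[OF assms(1,2), of "y - z"] by force
qed

text \<open>Positivity of the metric makes the defining equation of \<open>christoffel\<close>
  uniquely solvable, which discharges the definite description; afterwards
  \<open>christoffel\<close> is handled only through its inner products.\<close>

lemma gmet_christoffel:
  assumes "\<kappa> \<in> A" "x \<in> chart_image \<kappa>"
  shows "gmet \<kappa> x (christoffel A h \<kappa> x u v) w = christoffel1 \<kappa> x u v w"
proof -
  have lin: "linear (christoffel1 \<kappa> x u v)"
    by (intro linearI) (simp_all add: christoffel1_def dgmet_linear_simps assms field_simps)
  have "\<exists>!z. \<forall>w. gmet \<kappa> x z w = christoffel1 \<kappa> x u v w"
    by (rule bilinear_riesz[OF bilinear_gmet[OF assms] gmet_pos[OF assms] lin])
  then have "\<forall>w. gmet \<kappa> x (THE z. \<forall>w. gmet \<kappa> x z w = christoffel1 \<kappa> x u v w) w = christoffel1 \<kappa> x u v w"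
    by (rule theI')
  then show ?thesis by (simp add: christoffel_def christoffel1_def Let_def)
qed

lemma linear_christoffel:
  assumes "\<kappa> \<in> A" "x \<in> chart_image \<kappa>"
  shows "linear (christoffel A h \<kappa> x u)"
proof -
  have l: "linear (\<lambda>v. christoffel1 \<kappa> x u v w)" for w
    by (intro linearI) (simp_all add: christoffel1_def dgmet_linear_simps assms field_simps)
  show ?thesis
    by (rule linearI; rule gmet_nondegenerate[OF assms])
      (simp_all add: gmet_christoffel[OF assms] bilinear_ladd[OF bilinear_gmet[OF assms]]
        bilinear_lmul[OF bilinear_gmet[OF assms]] linear_add[OF l] linear_scale[OF l])
qed

section \<open>Behaviour under a change of chart\<close>

lemma gmet_transition:
  assumes "\<kappa> \<in> A" "\<mu> \<in> A" "p \<in> fst \<kappa>" "p \<in> fst \<mu>"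
  shows "gmet \<kappa> (snd \<kappa> p) u v = gmet \<mu> (snd \<mu> p) (dtrans \<kappa> \<mu> p u) (dtrans \<kappa> \<mu> p v)"
  using assms
  by (simp add: gmet_chart[of \<kappa>] h_eq_gmet[of \<mu>] coord_vec_in_tangent_space coord_vec_apply)

text \<open>Obtained by differentiating the invariance \<open>gmet_transition\<close> along the
  coordinate line through the point in direction d. One term comes from the moving base point, the
  other two from the differentials of the transition map in the two arguments.\<close>

lemma dgmet_transition:
  assumes \<kappa>: "\<kappa> \<in> A" "p \<in> fst \<kappa>" and \<mu>: "\<mu> \<in> A" "p \<in> fst \<mu>"
  defines "D2 \<equiv> \<lambda>d a. frechet_derivative (\<lambda>x. frechet_derivative (transition \<kappa> \<mu>) (at x) a) (at (snd \<kappa> p)) d"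
  shows "dgmet \<kappa> (snd \<kappa> p) d a b =
    dgmet \<mu> (snd \<mu> p) (dtrans \<kappa> \<mu> p d) (dtrans \<kappa> \<mu> p a) (dtrans \<kappa> \<mu> p b)
    + gmet \<mu> (snd \<mu> p) (D2 d a) (dtrans \<kappa> \<mu> p b) + gmet \<mu> (snd \<mu> p) (dtrans \<kappa> \<mu> p a) (D2 d b)"
proof -
  let ?O = "snd \<kappa> ` (fst \<kappa> \<inter> fst \<mu>)" and ?x = "snd \<kappa> p" and ?D = "\<lambda>x. frechet_derivative (transition \<kappa> \<mu>) (at x)"
  let ?c = "\<lambda>s. ?x + s *\<^sub>R d"
  have O: "open ?O" "?x \<in> ?O" using assms open_overlap by auto
  have c: "(?c has_vector_derivative d) (at t)" for t
    by (auto intro!: derivative_eq_intros)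
  have c0: "?c 0 = ?x" by simp
  define T where "T = ?c -` ?O"
  have T: "open T" "0 \<in> T"
    unfolding T_def using O by (auto intro!: continuous_open_vimage continuous_intros)
  have L: "((\<lambda>s. gmet \<kappa> (?c s) a b) has_vector_derivative dgmet \<kappa> ?x d a b) (at 0)"
    by (rule has_vector_derivative_compose_frechet[OF _ c]) (use has_derivative_gmet \<kappa> in auto)
  have trans': "((\<lambda>s. transition \<kappa> \<mu> (?c s)) has_vector_derivative dtrans \<kappa> \<mu> p d) (at 0)"
    by (rule has_vector_derivative_compose_frechet[OF _ c]) (use has_derivative_transition assms in auto)
  have "((\<lambda>s. gmet \<mu> (transition \<kappa> \<mu> (?c s)) (?D (?c s) a) (?D (?c s) b)) has_vector_derivative
     dgmet \<mu> (snd \<mu> p) (dtrans \<kappa> \<mu> p d) (?D (?c 0) a) (?D (?c 0) b)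
      + gmet \<mu> (transition \<kappa> \<mu> (?c 0)) (D2 d a) (?D (?c 0) b) + gmet \<mu> (transition \<kappa> \<mu> (?c 0)) (?D (?c 0) a) (D2 d b)) (at 0)"
  proof (rule has_vector_derivative_bilinear_family)
    show "\<forall>\<^sub>F s in nhds 0. bilinear (gmet \<mu> (transition \<kappa> \<mu> (?c s)))"
      using eventually_nhds_in_open[OF T]
    proof eventually_elim
      case (elim s)
      then obtain q where "q \<in> fst \<kappa>" "q \<in> fst \<mu>" "?c s = snd \<kappa> q" by (auto simp: T_def)
      then show ?case using \<kappa> \<mu> by (simp add: transition_chart bilinear_gmet)
    qed
    show "((\<lambda>s. gmet \<mu> (transition \<kappa> \<mu> (?c s)) w z) has_vector_derivative
        dgmet \<mu> (snd \<mu> p) (dtrans \<kappa> \<mu> p d) w z) (at 0)" for w z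
      by (rule has_vector_derivative_compose_frechet[OF _ trans'])
        (use has_derivative_gmet[of \<mu> "snd \<mu> p" w z] \<kappa> \<mu> in \<open>simp add: transition_chart\<close>)
    have D': "((\<lambda>s. ?D (?c s) a) has_vector_derivative D2 d a) (at 0)" for a
      unfolding D2_def
      by (rule has_vector_derivative_compose_frechet[OF _ c], unfold c0,
          rule smooth_on_has_derivative[OF smooth_on_frechet_derivative[OF smooth_transition] O])
        (use \<kappa> \<mu> in auto)
    show "((\<lambda>s. ?D (?c s) a) has_vector_derivative D2 d a) (at 0)"
      and "((\<lambda>s. ?D (?c s) b) has_vector_derivative D2 d b) (at 0)" by (fact D')+
  qed
  then have "((\<lambda>s. gmet \<kappa> (?c s) a b) has_vector_derivative
     dgmet \<mu> (snd \<mu> p) (dtrans \<kappa> \<mu> p d) (?D (?c 0) a) (?D (?c 0) b)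
      + gmet \<mu> (transition \<kappa> \<mu> (?c 0)) (D2 d a) (?D (?c 0) b) + gmet \<mu> (transition \<kappa> \<mu> (?c 0)) (?D (?c 0) a) (D2 d b)) (at 0)"
  proof (rule has_vector_derivative_transform_within_open[OF _ T])
    fix s assume "s \<in> T"
    then obtain q where "q \<in> fst \<kappa>" "q \<in> fst \<mu>" "?c s = snd \<kappa> q" by (auto simp: T_def)
    then show "gmet \<mu> (transition \<kappa> \<mu> (?c s)) (?D (?c s) a) (?D (?c s) b) = gmet \<kappa> (?c s) a b"
      using \<kappa> \<mu> gmet_transition[of \<kappa> \<mu> q a b] by (simp add: transition_chart)
  qed
  from vector_derivative_unique_at[OF L this] show ?thesis
    using \<kappa> \<mu> by (simp add: transition_chart)
qed

lemma christoffel_transition: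
  assumes \<kappa>: "\<kappa> \<in> A" "p \<in> fst \<kappa>" and \<mu>: "\<mu> \<in> A" "p \<in> fst \<mu>"
  shows "christoffel A h \<mu> (snd \<mu> p) (dtrans \<kappa> \<mu> p u) (dtrans \<kappa> \<mu> p v) =
    dtrans \<kappa> \<mu> p (christoffel A h \<kappa> (snd \<kappa> p) u v)
    - frechet_derivative (\<lambda>x. frechet_derivative (transition \<kappa> \<mu>) (at x) v) (at (snd \<kappa> p)) u"
proof -
  \<comment> \<open>The second derivative of the transition map enters six terms of the Christoffel sum; as it is
    symmetric, four of them cancel.\<close>
  define D2 where "D2 d a = frechet_derivative (\<lambda>x. frechet_derivative (transition \<kappa> \<mu>) (at x) a) (at (snd \<kappa> p)) d" for d a
  let ?D = "dtrans \<kappa> \<mu> p" and ?x = "snd \<kappa> p" and ?y = "snd \<mu> p"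
  have D2_commute: "D2 a b = D2 b a" for a b
    unfolding D2_def using \<kappa> \<mu> by (intro symmetric_second_derivative[OF smooth_transition open_overlap]) auto
  have x: "?x \<in> chart_image \<kappa>" and y: "?y \<in> chart_image \<mu>" using \<kappa> \<mu> by auto
  note dg = dgmet_transition[OF \<kappa> \<mu>, folded D2_def]
  have "christoffel1 \<kappa> ?x u v w = christoffel1 \<mu> ?y (?D u) (?D v) (?D w) + gmet \<mu> ?y (D2 u v) (?D w)" for w
    unfolding christoffel1_def dg
    using D2_commute[of v u] D2_commute[of w u] D2_commute[of w v]
      gmet_commute[OF \<mu>(1) y, of "?D u" "D2 v w"] gmet_commute[OF \<mu>(1) y, of "D2 u w" "?D v"]
    by (simp add: field_simps)
  then have *: "gmet \<mu> ?y (?D (christoffel A h \<kappa> ?x u v)) (?D w) =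
      gmet \<mu> ?y (christoffel A h \<mu> ?y (?D u) (?D v) + D2 u v) (?D w)" for w
    using gmet_transition[OF \<kappa>(1) \<mu>(1) \<kappa>(2) \<mu>(2), of "christoffel A h \<kappa> ?x u v" w]
    by (simp add: gmet_christoffel[OF \<kappa>(1) x] gmet_christoffel[OF \<mu>(1) y]
        bilinear_ladd[OF bilinear_gmet[OF \<mu>(1) y]])
  \<comment> \<open>The identity is known only for test vectors in the image of the differential;
    invertibility turns these into all test vectors, as nondegeneracy demands.\<close>
  have surj: "?D (dtrans \<mu> \<kappa> p w) = w" for w
    using \<kappa> \<mu> by (simp add: dtrans_compose dtrans_id)
  have "?D (christoffel A h \<kappa> ?x u v) = christoffel A h \<mu> ?y (?D u) (?D v) + D2 u v"
    by (rule gmet_nondegenerate[OF \<mu>(1) y]) (use *[of "dtrans \<mu> \<kappa> p w" for w] surj in metis)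
  then show ?thesis by (simp add: D2_def)
qed

end

section \<open>Parallel translation\<close>

lemma continuous_on_locally:
  fixes f :: "'a::t2_space \<Rightarrow> 'b::topological_space"
  assumes "\<And>t. t \<in> S \<Longrightarrow> \<exists>T. open T \<and> t \<in> T \<and> continuous_on (S \<inter> T) f"
  shows "continuous_on S f"
  unfolding continuous_on_eq_continuous_within
proof
  fix t assume t: "t \<in> S"
  then obtain T where T: "open T" "t \<in> T" "continuous_on (S \<inter> T) f" using assms by blast
  then have "continuous (at t within S \<inter> T) f"
    using t by (simp add: continuous_on_eq_continuous_within)
  moreover have "at t within S \<inter> T = at t within S"
    using T by (intro at_within_nhd[of _ T]) auto
  ultimately show "continuous (at t within S) f" by simp
qed

lemma has_derivative_imp_has_vector_derivative:
  assumes "(f has_derivative F) (at t)"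
  shows "(f has_vector_derivative F 1) (at t)"
proof -
  have F: "(\<lambda>s. s *\<^sub>R F 1) = F"
  proof
    show "s *\<^sub>R F 1 = F s" for s
      using linear_scale[OF has_derivative_linear[OF assms], of s 1] by simp
  qed
  show ?thesis unfolding has_vector_derivative_def F by (rule assms)
qed

lemma smooth_on_vector_derivative:
  fixes f :: "real \<Rightarrow> 'f::real_normed_vector"
  assumes "smooth_on T f" "open T"
  shows "t \<in> T \<Longrightarrow> (f has_vector_derivative vector_derivative f (at t)) (at t)"
    and "continuous_on T (\<lambda>t. vector_derivative f (at t))"
proof -
  have d: "(f has_vector_derivative frechet_derivative f (at t) 1) (at t)" if "t \<in> T" for t
    by (intro has_derivative_imp_has_vector_derivative smooth_on_has_derivative[OF assms that])
  then show "t \<in> T \<Longrightarrow> (f has_vector_derivative vector_derivative f (at t)) (at t)"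
    using vector_derivative_at by metis
  have "continuous_on T (\<lambda>t. frechet_derivative f (at t) 1)"
    by (intro smooth_on_imp_continuous_on smooth_on_frechet_derivative assms)
  then show "continuous_on T (\<lambda>t. vector_derivative f (at t))"
    by (rule continuous_on_eq) (use vector_derivative_at[OF d] in simp)
qed

text \<open>The induction starts with the first piece rather than a one-point interval, so P is only
  ever asserted on pieces and their concatenations.\<close>

lemma piecewise_induct:
  fixes P :: "real \<Rightarrow> real \<Rightarrow> bool"
  assumes "0 < n" "\<And>i. i < n \<Longrightarrow> \<tau> i < \<tau> (Suc i)" "\<And>i. i < n \<Longrightarrow> P (\<tau> i) (\<tau> (Suc i))"
    and join: "\<And>a b c. a \<le> b \<Longrightarrow> b \<le> c \<Longrightarrow> P a b \<Longrightarrow> P b c \<Longrightarrow> P a c"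
  shows "P (\<tau> 0) (\<tau> n)"
proof -
  have "m < n \<Longrightarrow> \<tau> 0 \<le> \<tau> (Suc m) \<and> P (\<tau> 0) (\<tau> (Suc m))" for m
  proof (induction m)
    case 0
    then show ?case using assms(2,3)[of 0] by simp
  next
    case (Suc m)
    then have "\<tau> 0 \<le> \<tau> (Suc m)" "P (\<tau> 0) (\<tau> (Suc m))" by auto
    moreover have "\<tau> (Suc m) < \<tau> (Suc (Suc m))" using assms(2) Suc.prems by blast
    ultimately show ?case using join[of "\<tau> 0" "\<tau> (Suc m)" "\<tau> (Suc (Suc m))"] assms(3)[OF Suc.prems] by simp
  qed
  from this[of "n - 1"] assms(1) show ?thesis by simp
qed

context riemannian_manifold
begin

section \<open>Parallel fields: linear combinations, restriction, gluing\<close>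

lemma smooth_curve_chart:
  assumes "smooth_curve_on A J \<gamma>" "\<kappa> \<in> A"
  shows "open (J \<inter> \<gamma> -` fst \<kappa>)" "smooth_on (J \<inter> \<gamma> -` fst \<kappa>) (snd \<kappa> \<circ> \<gamma>)"
  using assms continuous_open_preimage[OF _ _ open_domain[OF assms(2)], of J \<gamma>]
  unfolding smooth_curve_on_def by auto

lemma parallel_alongD:
  assumes "parallel_along A h c a b V"
  shows "t \<in> {a..b} \<Longrightarrow> V t \<in> tangent_space A (c t)"
    and "\<kappa> \<in> A \<Longrightarrow> continuous_on ({a..b} \<inter> c -` fst \<kappa>) (\<lambda>t. V t \<kappa>)"
    and "\<exists>S. finite S \<and>
        (\<forall>t\<in>{a<..<b} - S. \<forall>\<kappa>\<in>A. c t \<in> fst \<kappa> \<longrightarrow>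
           ((\<lambda>s. V s \<kappa>) has_vector_derivative
              - christoffel A h \<kappa> (snd \<kappa> (c t)) (vector_derivative (snd \<kappa> \<circ> c) (at t)) (V t \<kappa>)) (at t))"
  using assms unfolding parallel_along_def by blast+

lemma parallel_along_lincomb:
  assumes V: "parallel_along A h c a b V" and U: "parallel_along A h c a b U"
  shows "parallel_along A h c a b (\<lambda>t. r *\<^sub>R V t + s *\<^sub>R U t)"
  unfolding parallel_along_def
proof (intro conjI ballI)
  show "r *\<^sub>R V t + s *\<^sub>R U t \<in> tangent_space A (c t)" if "t \<in> {a..b}" for t
    using parallel_alongD(1)[OF V that] parallel_alongD(1)[OF U that] by (intro tangent_space_closed)
  show "continuous_on ({a..b} \<inter> c -` fst \<kappa>) (\<lambda>t. (r *\<^sub>R V t + s *\<^sub>R U t) \<kappa>)" if "\<kappa> \<in> A" for \<kappa>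
    unfolding plus_fun_def scaleR_fun_def
    using parallel_alongD(2)[OF V that] parallel_alongD(2)[OF U that] by (intro continuous_intros)
  obtain S1 where S1: "finite S1" "\<And>t \<kappa>. t \<in> {a<..<b} - S1 \<Longrightarrow> \<kappa> \<in> A \<Longrightarrow> c t \<in> fst \<kappa> \<Longrightarrow>
     ((\<lambda>s. V s \<kappa>) has_vector_derivative
        - christoffel A h \<kappa> (snd \<kappa> (c t)) (vector_derivative (snd \<kappa> \<circ> c) (at t)) (V t \<kappa>)) (at t)"
    using parallel_alongD(3)[OF V] by blast
  obtain S2 where S2: "finite S2" "\<And>t \<kappa>. t \<in> {a<..<b} - S2 \<Longrightarrow> \<kappa> \<in> A \<Longrightarrow> c t \<in> fst \<kappa> \<Longrightarrow>
     ((\<lambda>s. U s \<kappa>) has_vector_derivative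
        - christoffel A h \<kappa> (snd \<kappa> (c t)) (vector_derivative (snd \<kappa> \<circ> c) (at t)) (U t \<kappa>)) (at t)"
    using parallel_alongD(3)[OF U] by blast
  have "((\<lambda>x. (r *\<^sub>R V x + s *\<^sub>R U x) \<kappa>) has_vector_derivative
      - christoffel A h \<kappa> (snd \<kappa> (c t)) (vector_derivative (snd \<kappa> \<circ> c) (at t)) ((r *\<^sub>R V t + s *\<^sub>R U t) \<kappa>)) (at t)"
    if t: "t \<in> {a<..<b} - (S1 \<union> S2)" and \<kappa>: "\<kappa> \<in> A" "c t \<in> fst \<kappa>" for t \<kappa>
  proof -
    have lin: "linear (christoffel A h \<kappa> (snd \<kappa> (c t)) x)" for x
      using \<kappa> by (intro linear_christoffel) auto
    have "((\<lambda>x. r *\<^sub>R V x \<kappa> + s *\<^sub>R U x \<kappa>) has_vector_derivative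
        r *\<^sub>R (- christoffel A h \<kappa> (snd \<kappa> (c t)) (vector_derivative (snd \<kappa> \<circ> c) (at t)) (V t \<kappa>)) +
        s *\<^sub>R (- christoffel A h \<kappa> (snd \<kappa> (c t)) (vector_derivative (snd \<kappa> \<circ> c) (at t)) (U t \<kappa>))) (at t)"
      by (intro has_vector_derivative_add bounded_linear.has_vector_derivative[OF bounded_linear_scaleR_right]
          S1(2) S2(2)) (use t \<kappa> in auto)
    then show ?thesis
      by (simp add: plus_fun_def scaleR_fun_def linear_add[OF lin] linear_scale[OF lin])
  qed
  then show "\<exists>S. finite S \<and>
        (\<forall>t\<in>{a<..<b} - S. \<forall>\<kappa>\<in>A. c t \<in> fst \<kappa> \<longrightarrow>
           ((\<lambda>x. (r *\<^sub>R V x + s *\<^sub>R U x) \<kappa>) has_vector_derivative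
              - christoffel A h \<kappa> (snd \<kappa> (c t)) (vector_derivative (snd \<kappa> \<circ> c) (at t))
                  ((r *\<^sub>R V t + s *\<^sub>R U t) \<kappa>)) (at t))"
    using S1(1) S2(1) by (intro exI[of _ "S1 \<union> S2"]) blast
qed

lemma parallel_along_subinterval:
  assumes V: "parallel_along A h c a b V" and "a \<le> a'" "b' \<le> b"
  shows "parallel_along A h c a' b' V"
proof -
  have "{a'..b'} \<subseteq> {a..b}" "{a'<..<b'} \<subseteq> {a<..<b}" using assms by auto
  then show ?thesis
    using V unfolding parallel_along_def
    by (meson Diff_iff Int_mono continuous_on_subset order_refl subset_iff)
qed

text \<open>The equation is imposed at interior parameters only, where agreement on the interval
  determines the velocity. This allows a piece of a curve to be exchanged for its smooth extension
  to an open set.\<close>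

lemma parallel_along_cong:
  assumes V: "parallel_along A h c a b V" and eq: "\<And>t. t \<in> {a..b} \<Longrightarrow> c t = c' t"
  shows "parallel_along A h c' a b V"
proof -
  have D: "vector_derivative (snd \<kappa> \<circ> c) (at t) = vector_derivative (snd \<kappa> \<circ> c') (at t)"
    if t: "t \<in> {a<..<b}" for \<kappa> :: "('a, 'e) chart" and t
  proof -
    have "((snd \<kappa> \<circ> c) has_vector_derivative D) (at t) \<longleftrightarrow> ((snd \<kappa> \<circ> c') has_vector_derivative D) (at t)" for D
    proof
      assume "((snd \<kappa> \<circ> c) has_vector_derivative D) (at t)"
      then show "((snd \<kappa> \<circ> c') has_vector_derivative D) (at t)"
        by (rule has_vector_derivative_transform_within_open[of _ _ _ "{a<..<b}"]) (use t eq in auto)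
    next
      assume "((snd \<kappa> \<circ> c') has_vector_derivative D) (at t)"
      then show "((snd \<kappa> \<circ> c) has_vector_derivative D) (at t)"
        by (rule has_vector_derivative_transform_within_open[of _ _ _ "{a<..<b}"]) (use t eq in auto)
    qed
    then show ?thesis by (simp add: vector_derivative_def)
  qed
  have S: "{a..b} \<inter> c' -` U = {a..b} \<inter> c -` U" for U using eq by auto
  obtain E where E: "finite E" "\<And>t \<kappa>. t \<in> {a<..<b} - E \<Longrightarrow> \<kappa> \<in> A \<Longrightarrow> c t \<in> fst \<kappa> \<Longrightarrow>
     ((\<lambda>s. V s \<kappa>) has_vector_derivative
        - christoffel A h \<kappa> (snd \<kappa> (c t)) (vector_derivative (snd \<kappa> \<circ> c) (at t)) (V t \<kappa>)) (at t)"
    using parallel_alongD(3)[OF V] by blast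
  show ?thesis
    unfolding parallel_along_def S
  proof (intro conjI ballI exI[of _ E] impI E(1))
    show "V t \<in> tangent_space A (c' t)" if "t \<in> {a..b}" for t
      using parallel_alongD(1)[OF V that] eq[OF that] by simp
    show "continuous_on ({a..b} \<inter> c -` fst \<kappa>) (\<lambda>t. V t \<kappa>)" if "\<kappa> \<in> A" for \<kappa>
      using parallel_alongD(2)[OF V that] .
    fix t \<kappa> assume t: "t \<in> {a<..<b} - E" "\<kappa> \<in> A" "c' t \<in> fst \<kappa>"
    then show "((\<lambda>s. V s \<kappa>) has_vector_derivative
        - christoffel A h \<kappa> (snd \<kappa> (c' t)) (vector_derivative (snd \<kappa> \<circ> c') (at t)) (V t \<kappa>)) (at t)"
      using E(2)[of t \<kappa>] eq[of t] D[of t \<kappa>] by simp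
  qed
qed

text \<open>The common parameter b is added to the exceptional set, since the field may have a
  corner there; the matching condition at b keeps it continuous.\<close>

lemma parallel_along_join:
  assumes V: "parallel_along A h c a b V" and U: "parallel_along A h c b d U"
    and "a \<le> b" "b \<le> d" "V b = U b"
  shows "parallel_along A h c a d (\<lambda>t. if t \<le> b then V t else U t)"
  unfolding parallel_along_def
proof (intro conjI ballI)
  let ?W = "\<lambda>t. if t \<le> b then V t else U t"
  show "?W t \<in> tangent_space A (c t)" if "t \<in> {a..d}" for t
    using parallel_alongD(1)[OF V, of t] parallel_alongD(1)[OF U, of t] that by auto
  show "continuous_on ({a..d} \<inter> c -` fst \<kappa>) (\<lambda>t. ?W t \<kappa>)" if "\<kappa> \<in> A" for \<kappa>
  proof -
    have "continuous_on ({a..d} \<inter> c -` fst \<kappa>) (\<lambda>t. if t \<le> b then V t \<kappa> else U t \<kappa>)"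
    proof (rule continuous_on_cases_le)
      show "continuous_on {t \<in> {a..d} \<inter> c -` fst \<kappa>. t \<le> b} (\<lambda>t. V t \<kappa>)"
        by (rule continuous_on_subset[OF parallel_alongD(2)[OF V that]]) auto
      show "continuous_on {t \<in> {a..d} \<inter> c -` fst \<kappa>. b \<le> t} (\<lambda>t. U t \<kappa>)"
        by (rule continuous_on_subset[OF parallel_alongD(2)[OF U that]]) auto
    qed (use assms(5) in auto)
    then show ?thesis by (rule continuous_on_eq) auto
  qed
  obtain S1 where S1: "finite S1" "\<And>t \<kappa>. t \<in> {a<..<b} - S1 \<Longrightarrow> \<kappa> \<in> A \<Longrightarrow> c t \<in> fst \<kappa> \<Longrightarrow>
     ((\<lambda>s. V s \<kappa>) has_vector_derivative
        - christoffel A h \<kappa> (snd \<kappa> (c t)) (vector_derivative (snd \<kappa> \<circ> c) (at t)) (V t \<kappa>)) (at t)"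
    using parallel_alongD(3)[OF V] by blast
  obtain S2 where S2: "finite S2" "\<And>t \<kappa>. t \<in> {b<..<d} - S2 \<Longrightarrow> \<kappa> \<in> A \<Longrightarrow> c t \<in> fst \<kappa> \<Longrightarrow>
     ((\<lambda>s. U s \<kappa>) has_vector_derivative
        - christoffel A h \<kappa> (snd \<kappa> (c t)) (vector_derivative (snd \<kappa> \<circ> c) (at t)) (U t \<kappa>)) (at t)"
    using parallel_alongD(3)[OF U] by blast
  have "((\<lambda>s. ?W s \<kappa>) has_vector_derivative
      - christoffel A h \<kappa> (snd \<kappa> (c t)) (vector_derivative (snd \<kappa> \<circ> c) (at t)) (?W t \<kappa>)) (at t)"
    if t: "t \<in> {a<..<d} - (S1 \<union> S2 \<union> {b})" and \<kappa>: "\<kappa> \<in> A" "c t \<in> fst \<kappa>" for t \<kappa>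
  proof (cases "t < b")
    case True
    show ?thesis
      by (rule has_vector_derivative_transform_within_open[where S="{..<b}" and f="\<lambda>s. V s \<kappa>"])
        (use S1(2)[of t \<kappa>] t \<kappa> True in auto)
  next
    case False
    show ?thesis
      by (rule has_vector_derivative_transform_within_open[where S="{b<..}" and f="\<lambda>s. U s \<kappa>"])
        (use S2(2)[of t \<kappa>] t \<kappa> False in auto)
  qed
  then show "\<exists>S. finite S \<and> (\<forall>t\<in>{a<..<d} - S. \<forall>\<kappa>\<in>A. c t \<in> fst \<kappa> \<longrightarrow>
     ((\<lambda>s. ?W s \<kappa>) has_vector_derivative
        - christoffel A h \<kappa> (snd \<kappa> (c t)) (vector_derivative (snd \<kappa> \<circ> c) (at t)) (?W t \<kappa>)) (at t))"
    using S1(1) S2(1) by (intro exI[of _ "S1 \<union> S2 \<union> {b}"]) blast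
qed

text \<open>Metric compatibility: the derivative of the inner product is the derivative of the
  metric along the curve minus the two Christoffel terms, which add up to the same quantity.\<close>

lemma parallel_along_smooth_isometry:
  assumes \<gamma>: "smooth_curve_on A J \<gamma>" and J: "{a..b} \<subseteq> J" and ab: "a \<le> b"
    and V: "parallel_along A h \<gamma> a b V" and U: "parallel_along A h \<gamma> a b U"
  shows "h (\<gamma> b) (V b) (U b) = h (\<gamma> a) (V a) (U a)"
proof -
  let ?f = "\<lambda>t. h (\<gamma> t) (V t) (U t)"
  obtain S1 where S1: "finite S1" "\<And>t \<kappa>. t \<in> {a<..<b} - S1 \<Longrightarrow> \<kappa> \<in> A \<Longrightarrow> \<gamma> t \<in> fst \<kappa> \<Longrightarrow>
     ((\<lambda>s. V s \<kappa>) has_vector_derivative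
        - christoffel A h \<kappa> (snd \<kappa> (\<gamma> t)) (vector_derivative (snd \<kappa> \<circ> \<gamma>) (at t)) (V t \<kappa>)) (at t)"
    using parallel_alongD(3)[OF V] by blast
  obtain S2 where S2: "finite S2" "\<And>t \<kappa>. t \<in> {a<..<b} - S2 \<Longrightarrow> \<kappa> \<in> A \<Longrightarrow> \<gamma> t \<in> fst \<kappa> \<Longrightarrow>
     ((\<lambda>s. U s \<kappa>) has_vector_derivative
        - christoffel A h \<kappa> (snd \<kappa> (\<gamma> t)) (vector_derivative (snd \<kappa> \<circ> \<gamma>) (at t)) (U t \<kappa>)) (at t)"
    using parallel_alongD(3)[OF U] by blast
  have f_chart: "?f t = gmet \<kappa> (snd \<kappa> (\<gamma> t)) (V t \<kappa>) (U t \<kappa>)" if "\<kappa> \<in> A" "\<gamma> t \<in> fst \<kappa>" "t \<in> {a..b}" for t \<kappa>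
    using that parallel_alongD(1)[OF V] parallel_alongD(1)[OF U] by (intro h_eq_gmet) auto
  have cont: "continuous_on {a..b} ?f"
  proof (rule continuous_on_locally)
    fix t assume t: "t \<in> {a..b}"
    obtain \<kappa> where \<kappa>: "\<kappa> \<in> A" "\<gamma> t \<in> fst \<kappa>" by (rule chart_around)
    let ?T = "J \<inter> \<gamma> -` fst \<kappa>"
    note T = smooth_curve_chart[OF \<gamma> \<kappa>(1)]
    have sub: "{a..b} \<inter> ?T \<subseteq> {a..b} \<inter> \<gamma> -` fst \<kappa>" by auto
    have x: "continuous_on ({a..b} \<inter> ?T) (\<lambda>s. snd \<kappa> (\<gamma> s))"
      using continuous_on_subset[OF smooth_on_imp_continuous_on[OF T(2)] Int_lower2]
      by (simp add: o_def)
    have "continuous_on ({a..b} \<inter> ?T) (\<lambda>s. gmet \<kappa> (snd \<kappa> (\<gamma> s)) (V s \<kappa>) (U s \<kappa>))"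
    proof (rule continuous_on_bilinear_family[where B="\<lambda>s. gmet \<kappa> (snd \<kappa> (\<gamma> s))"])
      show "continuous_on ({a..b} \<inter> ?T) (\<lambda>s. gmet \<kappa> (snd \<kappa> (\<gamma> s)) w z)" for w z
        by (rule continuous_on_compose2[OF smooth_on_imp_continuous_on[OF smooth_gmet[OF \<kappa>(1)]] x]) auto
    qed (use parallel_alongD(2)[OF V \<kappa>(1)] parallel_alongD(2)[OF U \<kappa>(1)] bilinear_gmet[OF \<kappa>(1)]
        continuous_on_subset[OF _ sub] in auto)
    then have "continuous_on ({a..b} \<inter> ?T) ?f"
      by (rule continuous_on_eq) (use f_chart \<kappa> in auto)
    then show "\<exists>T. open T \<and> t \<in> T \<and> continuous_on ({a..b} \<inter> T) ?f"
      using T(1) t J \<kappa> by (intro exI[of _ ?T]) auto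
  qed
  \<comment> \<open>The endpoints join the exceptional set because the equation is available only
    inside the interval. Continuity on the closed interval lets a vanishing derivative off a finite
    set still force constancy.\<close>
  have deriv: "(?f has_derivative (\<lambda>h. 0)) (at t within {a..b})" if t: "t \<in> {a..b} - (S1 \<union> S2 \<union> {a, b})" for t
  proof -
    obtain \<kappa> where \<kappa>: "\<kappa> \<in> A" "\<gamma> t \<in> fst \<kappa>" by (rule chart_around)
    let ?T = "J \<inter> \<gamma> -` fst \<kappa>"
    note T = smooth_curve_chart[OF \<gamma> \<kappa>(1)]
    have tT: "t \<in> ?T" and t': "t \<in> {a<..<b}" using t J \<kappa> by auto
    let ?x = "snd \<kappa> (\<gamma> t)" and ?x' = "vector_derivative (snd \<kappa> \<circ> \<gamma>) (at t)"
    have x: "?x \<in> chart_image \<kappa>" using \<kappa> by auto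
    let ?\<Gamma> = "christoffel A h \<kappa> ?x ?x'"
    have "((\<lambda>s. gmet \<kappa> ((snd \<kappa> \<circ> \<gamma>) s) (V s \<kappa>) (U s \<kappa>)) has_vector_derivative
        dgmet \<kappa> ?x ?x' (V t \<kappa>) (U t \<kappa>) + gmet \<kappa> ((snd \<kappa> \<circ> \<gamma>) t) (- ?\<Gamma> (V t \<kappa>)) (U t \<kappa>)
         + gmet \<kappa> ((snd \<kappa> \<circ> \<gamma>) t) (V t \<kappa>) (- ?\<Gamma> (U t \<kappa>))) (at t)"
    proof (rule has_vector_derivative_bilinear_family[where B="\<lambda>s. gmet \<kappa> ((snd \<kappa> \<circ> \<gamma>) s)"])
      show "\<forall>\<^sub>F s in nhds t. bilinear (gmet \<kappa> ((snd \<kappa> \<circ> \<gamma>) s))"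
        using eventually_nhds_in_open[OF T(1) tT]
        by eventually_elim (use \<kappa> in \<open>auto intro: bilinear_gmet\<close>)
      show "((\<lambda>s. gmet \<kappa> ((snd \<kappa> \<circ> \<gamma>) s) w z) has_vector_derivative dgmet \<kappa> ?x ?x' w z) (at t)" for w z
        by (rule has_vector_derivative_compose_frechet[OF _ smooth_on_vector_derivative(1)[OF T(2,1) tT]])
          (use has_derivative_gmet[OF \<kappa>(1) x] in simp)
    qed (use S1(2)[of t \<kappa>] S2(2)[of t \<kappa>] t t' \<kappa> in auto)
    \<comment> \<open>In the sum of the two symbols of the first kind, the derivatives of the metric
      in the directions of V and U cancel in pairs; the two halves in the direction of the velocity
      remain.\<close>
    moreover have "gmet \<kappa> ?x (- ?\<Gamma> (V t \<kappa>)) (U t \<kappa>) + gmet \<kappa> ?x (V t \<kappa>) (- ?\<Gamma> (U t \<kappa>))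
        = - dgmet \<kappa> ?x ?x' (V t \<kappa>) (U t \<kappa>)"
      using bilinear_lneg[OF bilinear_gmet[OF \<kappa>(1) x]] gmet_commute[OF \<kappa>(1) x, of "V t \<kappa>"]
        dgmet_commute[OF \<kappa>(1) x, of _ "U t \<kappa>"]
      by (simp add: gmet_christoffel[OF \<kappa>(1) x] christoffel1_def field_simps)
    ultimately have "((\<lambda>s. gmet \<kappa> (snd \<kappa> (\<gamma> s)) (V s \<kappa>) (U s \<kappa>)) has_derivative (\<lambda>h. 0)) (at t)"
      by (simp add: has_vector_derivative_def add.assoc)
    then have "(?f has_derivative (\<lambda>h. 0)) (at t)"
    proof (rule has_derivative_transform_within_open)
      show "open ({a<..<b} \<inter> ?T)" by (rule open_Int[OF open_greaterThanLessThan T(1)])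
      show "t \<in> {a<..<b} \<inter> ?T" using tT t' by simp
    qed (use f_chart \<kappa> in auto)
    then show ?thesis by (rule has_derivative_at_withinI)
  qed
  show ?thesis
    by (rule has_derivative_zero_unique_strong_interval[where x=b and k="S1 \<union> S2 \<union> {a, b}", OF _ cont refl deriv])
      (use S1(1) S2(1) ab in auto)
qed

section \<open>Existence of parallel fields\<close>

lemma continuous_on_christoffel_along:
  assumes \<gamma>: "smooth_curve_on A J \<gamma>" and \<kappa>: "\<kappa> \<in> A"
  shows "continuous_on (J \<inter> \<gamma> -` fst \<kappa>)
     (\<lambda>t. christoffel A h \<kappa> (snd \<kappa> (\<gamma> t)) (vector_derivative (snd \<kappa> \<circ> \<gamma>) (at t)) w)"
    (is "continuous_on ?T _")
proof -
  note T = smooth_curve_chart[OF \<gamma> \<kappa>]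
  let ?x = "\<lambda>t. snd \<kappa> (\<gamma> t)" and ?x' = "\<lambda>t. vector_derivative (snd \<kappa> \<circ> \<gamma>) (at t)"
  have x: "continuous_on ?T ?x"
    using smooth_on_imp_continuous_on[OF T(2)] by (simp add: o_def)
  have x': "continuous_on ?T ?x'"
    by (rule smooth_on_vector_derivative(2)[OF T(2,1)])
  have img: "?x t \<in> chart_image \<kappa>" if "t \<in> ?T" for t using that by auto
  have dg: "continuous_on ?T (\<lambda>t. dgmet \<kappa> (?x t) d a b)" for d a b
    by (rule continuous_on_compose2[OF smooth_on_imp_continuous_on[OF smooth_on_frechet_derivative[OF
              smooth_gmet[OF \<kappa>]]] x]) auto
  show ?thesis
  \<comment> \<open>The Christoffel vector is the solution of an equation with continuous
    coefficients: its inner products are symbols of the first kind, linear in the velocity and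
    continuous for fixed arguments.\<close>
  proof (rule continuous_on_bilinear_solution[where B="\<lambda>t. gmet \<kappa> (?x t)"])
    show "continuous_on ?T (\<lambda>t. gmet \<kappa> (?x t) a b)" for a b
      by (rule continuous_on_compose2[OF smooth_on_imp_continuous_on[OF smooth_gmet[OF \<kappa>]] x]) auto
    show "continuous_on ?T (\<lambda>t. gmet \<kappa> (?x t) (christoffel A h \<kappa> (?x t) (?x' t) w) z)" for z
    proof -
      have "continuous_on ?T (\<lambda>t. dgmet \<kappa> (?x t) (?x' t) w z)"
        by (rule continuous_on_linear_family[where \<Phi>="\<lambda>t d. dgmet \<kappa> (?x t) d w z", OF _ dg x'])
          (rule linear_dgmet_direction[OF \<kappa> img])
      moreover have "continuous_on ?T (\<lambda>t. dgmet \<kappa> (?x t) w (?x' t) z)"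
        by (rule continuous_on_linear_family[where \<Phi>="\<lambda>t d. dgmet \<kappa> (?x t) w d z", OF _ dg x'])
          (rule linear_dgmet[OF \<kappa> img])
      moreover have "continuous_on ?T (\<lambda>t. dgmet \<kappa> (?x t) z (?x' t) w)"
        by (rule continuous_on_linear_family[where \<Phi>="\<lambda>t d. dgmet \<kappa> (?x t) z d w", OF _ dg x'])
          (rule linear_dgmet[OF \<kappa> img])
      ultimately have "continuous_on ?T (\<lambda>t. christoffel1 \<kappa> (?x t) (?x' t) w z)"
        unfolding christoffel1_def by (intro continuous_intros) auto
      then show ?thesis
        by (rule continuous_on_eq) (use gmet_christoffel[OF \<kappa> img] in simp)
    qed
  qed (use bilinear_gmet[OF \<kappa> img] gmet_pos[OF \<kappa> img] in auto)
qed

text \<open>One d serves all intervals around t0 and all initial vectors at their left ends, which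
  is the local condition of a bisection argument. The solution is found as a coordinate vector in
  one chart and spread to all others by \<open>coord_vec\<close>.\<close>

lemma parallel_along_exists_local:
  assumes \<gamma>: "smooth_curve_on A J \<gamma>" and t0: "t0 \<in> J"
  obtains d where "d > 0"
    "\<And>y z v. y \<le> t0 \<Longrightarrow> t0 \<le> z \<Longrightarrow> z - y < d \<Longrightarrow> v \<in> tangent_space A (\<gamma> y) \<Longrightarrow>
       \<exists>V. parallel_along A h \<gamma> y z V \<and> V y = v"
proof -
  obtain \<kappa> where \<kappa>: "\<kappa> \<in> A" "\<gamma> t0 \<in> fst \<kappa>" by (rule chart_around)
  let ?T = "J \<inter> \<gamma> -` fst \<kappa>"
  note T = smooth_curve_chart[OF \<gamma> \<kappa>(1)]
  obtain e where e: "e > 0" "cball t0 e \<subseteq> ?T"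
    using T(1) t0 \<kappa>(2) open_contains_cball[of ?T] by blast
  then have eT: "{t0 - e..t0 + e} \<subseteq> ?T" by (simp add: cball_eq_atLeastAtMost)
  let ?x = "snd \<kappa> \<circ> \<gamma>" and ?x' = "\<lambda>t. vector_derivative (snd \<kappa> \<circ> \<gamma>) (at t)"
  let ?L = "\<lambda>t w. - christoffel A h \<kappa> (snd \<kappa> (\<gamma> t)) (?x' t) w"
  have linL: "linear (?L t)" if "t \<in> {t0 - e..t0 + e}" for t
    using eT that by (intro linear_compose_neg linear_christoffel \<kappa>) auto
  have contL: "continuous_on {t0 - e..t0 + e} (\<lambda>t. ?L t w)" for w
    by (intro continuous_on_minus continuous_on_subset[OF continuous_on_christoffel_along[OF \<gamma> \<kappa>(1)] eT])
  from linear_ode_local[of "t0 - e" "t0 + e" ?L, OF linL contL]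
  obtain d where d: "d > 0" "\<And>y z v0. t0 - e \<le> y \<Longrightarrow> y \<le> z \<Longrightarrow> z \<le> t0 + e \<Longrightarrow> z - y < d \<Longrightarrow>
     \<exists>v. v y = v0 \<and> (\<forall>t\<in>{y..z}. (v has_vector_derivative ?L t (v t)) (at t within {y..z}))"
    by blast
  show thesis
  \<comment> \<open>As t0 lies in [y, z], length below e keeps the interval inside the chart domain,
    and length below d makes the equation solvable.\<close>
  proof (rule that[of "min d e"])
    show "min d e > 0" using d(1) e(1) by simp
    fix y z u assume yz: "y \<le> t0" "t0 \<le> z" "z - y < min d e" and u: "u \<in> tangent_space A (\<gamma> y)"
    then obtain v where v: "v y = u \<kappa>"
      "\<And>t. t \<in> {y..z} \<Longrightarrow> (v has_vector_derivative ?L t (v t)) (at t within {y..z})"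
      using d(2)[of y z "u \<kappa>"] by auto
    have yzT: "{y..z} \<subseteq> ?T" using yz eT by (auto intro!: subsetD[OF eT])
    have contv: "continuous_on {y..z} v"
      using v(2) has_vector_derivative_continuous unfolding continuous_on_eq_continuous_within by blast
    define V where "V t = coord_vec A \<kappa> (\<gamma> t) (v t)" for t
    have V_apply: "V t \<mu> = frechet_derivative (transition \<kappa> \<mu>) (at (?x t)) (v t)"
      if "\<mu> \<in> A" "\<gamma> t \<in> fst \<mu>" for t \<mu>
      using that by (simp add: V_def coord_vec_apply)
    have "parallel_along A h \<gamma> y z V"
      unfolding parallel_along_def
    proof (intro conjI ballI exI[of _ "{}"] impI finite.emptyI)
      show "V t \<in> tangent_space A (\<gamma> t)" if "t \<in> {y..z}" for t
        unfolding V_def using that yzT \<kappa> by (intro coord_vec_in_tangent_space) auto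
      fix \<mu> assume \<mu>: "\<mu> \<in> A"
      let ?O = "snd \<kappa> ` (fst \<kappa> \<inter> fst \<mu>)"
      let ?D = "\<lambda>t. frechet_derivative (transition \<kappa> \<mu>) (at (?x t))"
      have xO: "?x t \<in> ?O" if "t \<in> ?T" "\<gamma> t \<in> fst \<mu>" for t using that by auto
      show "continuous_on ({y..z} \<inter> \<gamma> -` fst \<mu>) (\<lambda>t. V t \<mu>)"
      proof -
        have "continuous_on ({y..z} \<inter> \<gamma> -` fst \<mu>) (\<lambda>t. ?D t (v t))"
        proof (rule continuous_on_linear_family[where \<Phi>="?D"])
          show "linear (?D t)" if "t \<in> {y..z} \<inter> \<gamma> -` fst \<mu>" for t
            using that yzT \<kappa> \<mu> linear_dtrans[of \<kappa> \<mu> "\<gamma> t"] by auto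
          have x: "continuous_on ({y..z} \<inter> \<gamma> -` fst \<mu>) ?x"
            by (rule continuous_on_subset[OF smooth_on_imp_continuous_on[OF T(2)]]) (use yzT in auto)
          show "continuous_on ({y..z} \<inter> \<gamma> -` fst \<mu>) (\<lambda>t. ?D t w)" for w
            by (rule continuous_on_compose2[OF smooth_on_imp_continuous_on[OF smooth_on_frechet_derivative[OF
                      smooth_transition[OF \<kappa>(1) \<mu>]]] x]) (use xO yzT in blast)
          show "continuous_on ({y..z} \<inter> \<gamma> -` fst \<mu>) v"
            by (rule continuous_on_subset[OF contv]) auto
        qed
        then show ?thesis by (rule continuous_on_eq) (use V_apply[OF \<mu>] in auto)
      qed
    next
      fix t \<mu> assume t: "t \<in> {y<..<z} - {}" and \<mu>: "\<mu> \<in> A" "\<gamma> t \<in> fst \<mu>"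
      let ?O = "snd \<kappa> ` (fst \<kappa> \<inter> fst \<mu>)"
      let ?D = "\<lambda>t. frechet_derivative (transition \<kappa> \<mu>) (at (?x t))"
      let ?T' = "{y<..<z} \<inter> (J \<inter> \<gamma> -` fst \<mu>)"
      have T': "open ?T'" by (rule open_Int[OF open_greaterThanLessThan smooth_curve_chart(1)[OF \<gamma> \<mu>(1)]])
      have tT: "t \<in> ?T" using t by (intro subsetD[OF yzT]) simp
      have tT': "t \<in> ?T'" using t tT \<mu> by auto
      have T'T: "s \<in> ?T' \<Longrightarrow> s \<in> ?T" for s by (intro subsetD[OF yzT]) simp
      have pt: "\<gamma> t \<in> fst \<kappa>" using tT by auto
      have xO: "?x t \<in> ?O" using pt \<mu> by auto
      have x': "(?x has_vector_derivative ?x' t) (at t)"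
        by (rule smooth_on_vector_derivative(1)[OF T(2,1) tT])
      have v': "(v has_vector_derivative ?L t (v t)) (at t)"
        using v(2)[of t] t by (simp add: at_within_Icc_at)
      \<comment> \<open>In the new chart both the coordinate vector and the differential applied to
        it move; the latter contributes the second derivative of the transition map in the direction
        of the velocity.\<close>
      have "((\<lambda>s. ?D s (v s)) has_vector_derivative
          frechet_derivative (\<lambda>x. frechet_derivative (transition \<kappa> \<mu>) (at x) (v t)) (at (?x t)) (?x' t)
          + ?D t (?L t (v t))) (at t)"
      proof (rule has_vector_derivative_linear_family[where \<Phi>="?D" and
            \<Phi>'="\<lambda>w. frechet_derivative (\<lambda>x. frechet_derivative (transition \<kappa> \<mu>) (at x) w) (at (?x t)) (?x' t)", OF _ _ v'])
        show "\<forall>\<^sub>F s in nhds t. linear (?D s)"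
          using eventually_nhds_in_open[OF T' tT']
          by eventually_elim (use T'T \<kappa> \<mu> linear_dtrans[of \<kappa> \<mu> "\<gamma> _"] in auto)
        show "((\<lambda>s. ?D s w) has_vector_derivative
            frechet_derivative (\<lambda>x. frechet_derivative (transition \<kappa> \<mu>) (at x) w) (at (?x t)) (?x' t)) (at t)" for w
          by (rule has_vector_derivative_compose_frechet[OF smooth_on_has_derivative[OF
                  smooth_on_frechet_derivative[OF smooth_transition] open_overlap] x'])
            (use \<kappa> \<mu> xO in auto)
      qed
      then have VD: "((\<lambda>s. V s \<mu>) has_vector_derivative
          frechet_derivative (\<lambda>x. frechet_derivative (transition \<kappa> \<mu>) (at x) (v t)) (at (?x t)) (?x' t)
          + ?D t (?L t (v t))) (at t)"
        by (rule has_vector_derivative_transform_within_open[OF _ T' tT']) (use V_apply \<mu> in auto)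
      have "((\<lambda>s. transition \<kappa> \<mu> (?x s)) has_vector_derivative ?D t (?x' t)) (at t)"
        by (rule has_vector_derivative_compose_frechet[OF _ x'])
          (use has_derivative_transition \<kappa> \<mu> pt in auto)
      then have "((snd \<mu> \<circ> \<gamma>) has_vector_derivative ?D t (?x' t)) (at t)"
        by (rule has_vector_derivative_transform_within_open[OF _ T' tT'])
          (use T'T \<kappa> in \<open>auto simp: transition_chart\<close>)
      then have y': "vector_derivative (snd \<mu> \<circ> \<gamma>) (at t) = ?D t (?x' t)"
        by (rule vector_derivative_at)
      have lin: "linear (?D t)" using linear_dtrans[of \<kappa> \<mu> "\<gamma> t"] \<kappa> \<mu> pt by simp
      \<comment> \<open>The second derivative term is exactly the inhomogeneous term in the
        transformation law of the Christoffel symbols, so the equation keeps its form.\<close>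
      show "((\<lambda>s. V s \<mu>) has_vector_derivative
          - christoffel A h \<mu> (snd \<mu> (\<gamma> t)) (vector_derivative (snd \<mu> \<circ> \<gamma>) (at t)) (V t \<mu>)) (at t)"
        using VD christoffel_transition[OF \<kappa>(1) pt \<mu>, of "?x' t" "v t"]
        by (simp add: y' V_apply[OF \<mu>] linear_neg[OF lin[simplified]])
    qed
    moreover have "y \<in> ?T" using yz by (intro subsetD[OF yzT]) simp
    then have "V y = u"
      unfolding V_def v(1) using u \<kappa> by (intro coord_vec_of_coord) auto
    ultimately show "\<exists>V. parallel_along A h \<gamma> y z V \<and> V y = u" by blast
  qed
qed

lemma parallel_along_exists_smooth:
  assumes \<gamma>: "smooth_curve_on A J \<gamma>" and J: "{a..b} \<subseteq> J" and ab: "a \<le> b"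
    and v: "v \<in> tangent_space A (\<gamma> a)"
  shows "\<exists>V. parallel_along A h \<gamma> a b V \<and> V a = v"
proof -
  \<comment> \<open>The bisection property quantifies over all initial vectors, because the field on
    a right-hand interval must start at whatever value the field on the left has reached.\<close>
  have "a \<le> a \<longrightarrow> b \<le> b \<longrightarrow> (\<forall>v\<in>tangent_space A (\<gamma> a). \<exists>V. parallel_along A h \<gamma> a b V \<and> V a = v)"
    using ab
  proof (induction rule: Bolzano[where P="\<lambda>y z. a \<le> y \<longrightarrow> z \<le> b \<longrightarrow>
        (\<forall>v\<in>tangent_space A (\<gamma> y). \<exists>V. parallel_along A h \<gamma> y z V \<and> V y = v)"])
    case (trans x y z)
    show ?case
    proof (intro impI ballI)
      fix v assume "a \<le> x" "z \<le> b" "v \<in> tangent_space A (\<gamma> x)"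
      then obtain V where V: "parallel_along A h \<gamma> x y V" "V x = v" using trans by force
      then have "V y \<in> tangent_space A (\<gamma> y)"
        using parallel_alongD(1)[OF V(1), of y] trans by simp
      then obtain U where U: "parallel_along A h \<gamma> y z U" "U y = V y"
        using trans \<open>a \<le> x\<close> \<open>z \<le> b\<close> by force
      have "parallel_along A h \<gamma> x z (\<lambda>t. if t \<le> y then V t else U t)"
        by (rule parallel_along_join[OF V(1) U(1)]) (use U(2) trans in auto)
      moreover have "(if x \<le> y then V x else U x) = v" using V(2) trans by simp
      ultimately show "\<exists>V. parallel_along A h \<gamma> x z V \<and> V x = v" by blast
    qed
  next
    case (local x)
    then obtain d where "d > 0"
      "\<And>y z v. y \<le> x \<Longrightarrow> x \<le> z \<Longrightarrow> z - y < d \<Longrightarrow> v \<in> tangent_space A (\<gamma> y) \<Longrightarrow>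
       \<exists>V. parallel_along A h \<gamma> y z V \<and> V y = v"
      using parallel_along_exists_local[OF \<gamma>, of x] J by (metis atLeastAtMost_iff subsetD)
    then show ?case by (intro exI[of _ d]) blast
  qed
  then show ?thesis using v by blast
qed

text \<open>Both properties hold on each smooth piece and survive concatenation, so they are carried
  together through one induction over the pieces: existence by gluing, the isometry by restricting
  fields to the pieces.\<close>

lemma parallel_along_exists_isometry:
  assumes "piecewise_smooth_curve A c a b"
  shows "v \<in> tangent_space A (c a) \<Longrightarrow> \<exists>V. parallel_along A h c a b V \<and> V a = v"
    and "parallel_along A h c a b V \<Longrightarrow> parallel_along A h c a b U \<Longrightarrow>
      h (c b) (V b) (U b) = h (c a) (V a) (U a)"
proof -
  define P where "P a b \<longleftrightarrow>
    (\<forall>v\<in>tangent_space A (c a). \<exists>V. parallel_along A h c a b V \<and> V a = v) \<and>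
    (\<forall>V U. parallel_along A h c a b V \<longrightarrow> parallel_along A h c a b U \<longrightarrow>
       h (c b) (V b) (U b) = h (c a) (V a) (U a))" for a b
  obtain n \<tau> where \<tau>: "\<tau> 0 = a" "\<tau> n = b" "\<And>i. i < n \<Longrightarrow> \<tau> i < \<tau> (Suc i)"
    "\<And>i. i < n \<Longrightarrow> \<exists>J \<gamma>. {\<tau> i..\<tau> (Suc i)} \<subseteq> J \<and> smooth_curve_on A J \<gamma> \<and> (\<forall>t\<in>{\<tau> i..\<tau> (Suc i)}. c t = \<gamma> t)"
    and ab: "a < b"
    using assms unfolding piecewise_smooth_curve_def by blast
  have "P (\<tau> 0) (\<tau> n)"
  proof (rule piecewise_induct)
    show "0 < n" using \<tau>(1,2) ab by (cases n) auto
    show "P (\<tau> i) (\<tau> (Suc i))" if i: "i < n" for i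
    proof -
      obtain J \<gamma> where \<gamma>: "{\<tau> i..\<tau> (Suc i)} \<subseteq> J" "smooth_curve_on A J \<gamma>"
        "\<And>t. t \<in> {\<tau> i..\<tau> (Suc i)} \<Longrightarrow> c t = \<gamma> t" using \<tau>(4)[OF i] by blast
      have le: "\<tau> i \<le> \<tau> (Suc i)" using \<tau>(3)[OF i] by simp
      have to_\<gamma>: "parallel_along A h c (\<tau> i) (\<tau> (Suc i)) V \<longleftrightarrow> parallel_along A h \<gamma> (\<tau> i) (\<tau> (Suc i)) V" for V
        using parallel_along_cong \<gamma>(3) by metis
      show ?thesis
        unfolding P_def to_\<gamma>
        using parallel_along_exists_smooth[OF \<gamma>(2,1) le] parallel_along_smooth_isometry[OF \<gamma>(2,1) le]
          \<gamma>(3)[of "\<tau> i"] \<gamma>(3)[of "\<tau> (Suc i)"] le by simp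
    qed
    show "P x z" if le: "x \<le> y" "y \<le> z" and P: "P x y" "P y z" for x y z
      unfolding P_def
    proof (intro conjI ballI allI impI)
      fix v assume "v \<in> tangent_space A (c x)"
      then obtain V where V: "parallel_along A h c x y V" "V x = v" using P(1) unfolding P_def by blast
      then have "V y \<in> tangent_space A (c y)" using parallel_alongD(1)[OF V(1), of y] le by simp
      then obtain U where U: "parallel_along A h c y z U" "U y = V y" using P(2) unfolding P_def by blast
      have "parallel_along A h c x z (\<lambda>t. if t \<le> y then V t else U t)"
        by (rule parallel_along_join[OF V(1) U(1)]) (use U(2) le in auto)
      moreover have "(if x \<le> y then V x else U x) = v" using V(2) le by simp
      ultimately show "\<exists>V. parallel_along A h c x z V \<and> V x = v" by blast
    next
      fix V U assume VU: "parallel_along A h c x z V" "parallel_along A h c x z U"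
      have "h (c z) (V z) (U z) = h (c y) (V y) (U y)"
        using P(2) parallel_along_subinterval[OF VU(1), of y z] parallel_along_subinterval[OF VU(2), of y z] le
        unfolding P_def by blast
      also have "\<dots> = h (c x) (V x) (U x)"
        using P(1) parallel_along_subinterval[OF VU(1), of x y] parallel_along_subinterval[OF VU(2), of x y] le
        unfolding P_def by blast
      finally show "h (c z) (V z) (U z) = h (c x) (V x) (U x)" .
    qed
  qed (fact \<tau>(3))
  then have "P a b" by (simp add: \<tau>)
  then show "v \<in> tangent_space A (c a) \<Longrightarrow> \<exists>V. parallel_along A h c a b V \<and> V a = v"
    and "parallel_along A h c a b V \<Longrightarrow> parallel_along A h c a b U \<Longrightarrow>
      h (c b) (V b) (U b) = h (c a) (V a) (U a)"
    unfolding P_def by blast+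
qed

section \<open>Levi-Civita translation as a linear isometry\<close>

lemma levi_civita_translation_eq:
  assumes c: "piecewise_smooth_curve A c a b" and V: "parallel_along A h c a b V"
  shows "levi_civita_translation A h c a b (V a) = V b"
  unfolding levi_civita_translation_def
proof (rule the_equality)
  show "\<exists>U. parallel_along A h c a b U \<and> U a = V a \<and> U b = V b" using V by blast
  fix w assume "\<exists>U. parallel_along A h c a b U \<and> U a = V a \<and> U b = w"
  then obtain U where U: "parallel_along A h c a b U" "U a = V a" "U b = w" by blast
  \<comment> \<open>A parallel field that starts at 0 has length 0 at the end as well, so two fields
    with the same start have the same end.\<close>
  let ?W = "\<lambda>t. 1 *\<^sub>R U t + (-1) *\<^sub>R V t"
  have W: "parallel_along A h c a b ?W" using U(1) V by (rule parallel_along_lincomb)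
  have ab: "a \<le> b" using c by (simp add: piecewise_smooth_curve_def)
  have "h (c b) (?W b) (?W b) = h (c a) (?W a) (?W a)"
    by (rule parallel_along_exists_isometry(2)[OF c W W])
  also have "\<dots> = 0" using U(2) h_eq_0_iff[of 0] tangent_space_closed(1) by simp
  finally have "?W b = 0" using h_eq_0_iff parallel_alongD(1)[OF W, of b] ab by simp
  then show "w = V b" using U(3) by simp
qed

lemma levi_civita_translation_isometry:
  assumes c: "piecewise_smooth_curve A c a b"
    and u: "u \<in> tangent_space A (c a)" and v: "v \<in> tangent_space A (c a)"
  defines "P \<equiv> levi_civita_translation A h c a b"
  shows "P u \<in> tangent_space A (c b)"
    and "h (c b) (P u) (P v) = h (c a) u v"
    and "P (r *\<^sub>R u + s *\<^sub>R v) = r *\<^sub>R P u + s *\<^sub>R P v"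
proof -
  obtain U where U: "parallel_along A h c a b U" "U a = u"
    using parallel_along_exists_isometry(1)[OF c u] by blast
  obtain V where V: "parallel_along A h c a b V" "V a = v"
    using parallel_along_exists_isometry(1)[OF c v] by blast
  have ab: "a \<le> b" using c by (simp add: piecewise_smooth_curve_def)
  have Pu: "P u = U b" using levi_civita_translation_eq[OF c U(1)] U(2) by (simp add: P_def)
  have Pv: "P v = V b" using levi_civita_translation_eq[OF c V(1)] V(2) by (simp add: P_def)
  show "P u \<in> tangent_space A (c b)" using Pu parallel_alongD(1)[OF U(1), of b] ab by simp
  show "h (c b) (P u) (P v) = h (c a) u v"
    using parallel_along_exists_isometry(2)[OF c U(1) V(1)] U(2) V(2) Pu Pv by simp
  show "P (r *\<^sub>R u + s *\<^sub>R v) = r *\<^sub>R P u + s *\<^sub>R P v"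
    using levi_civita_translation_eq[OF c parallel_along_lincomb[OF U(1) V(1)], of r s] U(2) V(2) Pu Pv
    by (simp add: P_def)
qed

end

section \<open>The Randers norm and the natural translation\<close>

text \<open>For l = 1 - |W|^2, a = \<langle>y, W\<rangle> and b = |y|^2 the right-hand side says |y
  - W|^2 = 1. The equation is squared after isolating the root.\<close>

lemma randers_equation_iff:
  fixes a b l :: real
  assumes "l > 0" "b \<ge> 0"
  shows "sqrt (a\<^sup>2 + l * b) / l - a / l = 1 \<longleftrightarrow> b = l + 2 * a"
proof -
  have "sqrt (a\<^sup>2 + l * b) / l - a / l = 1 \<longleftrightarrow> sqrt (a\<^sup>2 + l * b) = l + a"
    using assms(1) by (auto simp: field_simps)
  also have "\<dots> \<longleftrightarrow> b = l + 2 * a"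
  proof
    assume s: "sqrt (a\<^sup>2 + l * b) = l + a"
    have "a\<^sup>2 + l * b = (l + a)\<^sup>2"
      using assms real_sqrt_pow2[of "a\<^sup>2 + l * b"] by (simp add: s)
    then have "l * b = l * (l + 2 * a)" by (simp add: power2_eq_square algebra_simps)
    then show "b = l + 2 * a" using assms(1) by simp
  next
    assume b: "b = l + 2 * a"
    then have "a\<^sup>2 + l * b = (l + a)\<^sup>2" by (simp add: power2_eq_square algebra_simps)
    \<comment> \<open>Squaring is reversible because 2 (l + a) = l + b is positive.\<close>
    moreover have "l + a \<ge> 0" using assms b by linarith
    ultimately show "sqrt (a\<^sup>2 + l * b) = l + a" by simp
  qed
  finally show ?thesis .
qed

context riemannian_manifold
begin

lemma navigation_data_imp:
  assumes "navigation_data A h W"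
  shows "W p \<in> tangent_space A p" "h p (W p) (W p) < 1"
  using assms unfolding navigation_data_def smooth_vector_field_def by blast+

lemma randers_norm_pos:
  assumes W: "navigation_data A h W" and y: "y \<in> tangent_space A p" "y \<noteq> 0"
  shows "randers_norm h W p y > 0"
proof -
  let ?l = "1 - h p (W p) (W p)" and ?a = "h p y (W p)"
  have l: "?l > 0" using navigation_data_imp[OF W, of p] by simp
  have "\<bar>?a\<bar> < sqrt (?a\<^sup>2 + ?l * h p y y)"
    using l h_pos[OF y] real_sqrt_less_mono[of "?a\<^sup>2" "?a\<^sup>2 + ?l * h p y y"] by simp
  then have "?a < sqrt (?a\<^sup>2 + ?l * h p y y)" by linarith
  then show ?thesis using l by (simp add: randers_norm_def Let_def divide_strict_right_mono)
qed

lemma randers_norm_scale: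
  assumes W: "navigation_data A h W" and y: "y \<in> tangent_space A p" and t: "t \<ge> 0"
  shows "randers_norm h W p (t *\<^sub>R y) = t * randers_norm h W p y"
proof -
  have "(t * h p y (W p))\<^sup>2 + (1 - h p (W p) (W p)) * (t * (t * h p y y)) =
      t\<^sup>2 * ((h p y (W p))\<^sup>2 + (1 - h p (W p) (W p)) * h p y y)"
    by (simp add: power2_eq_square algebra_simps)
  then show ?thesis
    using t y navigation_data_imp[OF W, of p]
    by (simp add: randers_norm_def Let_def h_scale_left h_scale_right tangent_space_closed
        real_sqrt_mult right_diff_distrib)
qed

lemma randers_norm_eq_1_iff:
  assumes W: "navigation_data A h W" and y: "y \<in> tangent_space A p"
  shows "randers_norm h W p y = 1 \<longleftrightarrow> h p (y - W p) (y - W p) = 1"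
proof -
  note Wp = navigation_data_imp[OF W, of p]
  have "h p (y - W p) (y - W p) = h p y y - 2 * h p y (W p) + h p (W p) (W p)"
    using y Wp h_commute[OF y Wp(1)] by (simp add: h_diff_left h_diff_right tangent_space_closed)
  moreover have "randers_norm h W p y = 1 \<longleftrightarrow> h p y y = (1 - h p (W p) (W p)) + 2 * h p y (W p)"
    unfolding randers_norm_def Let_def
    using Wp h_nonneg[OF y] by (intro randers_equation_iff) auto
  ultimately show ?thesis by auto
qed

text \<open>The normalised vector is the same for v and for t v, so only the factor in front of the
  translated unit vector changes.\<close>

lemma natural_translation_homogeneous:
  assumes W: "navigation_data A h W" and v: "v \<in> tangent_space A (c a)" and t: "t > 0"
  shows "natural_translation A h W c a b (t *\<^sub>R v) = t *\<^sub>R natural_translation A h W c a b v"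
  using t by (simp add: natural_translation_def Let_def randers_norm_scale[OF W v])

lemma randers_norm_natural_translation:
  assumes W: "navigation_data A h W" and c: "piecewise_smooth_curve A c a b"
    and v: "v \<in> tangent_space A (c a)" "v \<noteq> 0"
  shows "randers_norm h W (c b) (natural_translation A h W c a b v) = randers_norm h W (c a) v"
proof -
  define f where "f = randers_norm h W (c a) v"
  have f: "f > 0" using randers_norm_pos[OF W v] by (simp add: f_def)
  let ?u = "(1 / f) *\<^sub>R v" and ?P = "levi_civita_translation A h c a b"
  note Wa = navigation_data_imp[OF W, of "c a"] and Wb = navigation_data_imp[OF W, of "c b"]
  have u: "?u \<in> tangent_space A (c a)" using v(1) by (rule tangent_space_closed)
  have "randers_norm h W (c a) ?u = 1"
    using randers_norm_scale[OF W v(1), of "1 / f"] f by (simp add: f_def)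
  then have unit: "h (c a) (?u - W (c a)) (?u - W (c a)) = 1"
    using randers_norm_eq_1_iff[OF W u] by simp
  have d: "?u - W (c a) \<in> tangent_space A (c a)"
    by (intro tangent_space_closed u Wa)
  define y where "y = ?P (?u - W (c a)) + W (c b)"
  have y: "y \<in> tangent_space A (c b)"
    unfolding y_def using levi_civita_translation_isometry(1)[OF c d d] Wb
    by (intro tangent_space_closed)
  have "h (c b) (y - W (c b)) (y - W (c b)) = 1"
    unfolding y_def add_diff_cancel_right' using levi_civita_translation_isometry(2)[OF c d d] unit
    by (rule trans)
  then have "randers_norm h W (c b) y = 1"
    using randers_norm_eq_1_iff[OF W y] by simp
  then have "randers_norm h W (c b) (f *\<^sub>R y) = f"
    using randers_norm_scale[OF W y, of f] f by simp
  then show ?thesis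
    by (simp add: natural_translation_def natural_translation_unit_def Let_def f_def[symmetric] y_def)
qed

section \<open>A nonlinear natural translation\<close>

text \<open>In the chart the field is a constant coordinate vector times a bump function, rescaled
  to have length below 1 for h. Extension by zero is smooth because the bump lives in a compact
  coordinate ball, whose preimage is closed in the Hausdorff manifold.\<close>

lemma exists_bump_vector_field:
  assumes \<kappa>: "\<kappa> \<in> A" "p0 \<in> fst \<kappa>" and r: "r > 0" "cball (snd \<kappa> p0) r \<subseteq> chart_image \<kappa>"
  obtains W where "navigation_data A h W" "W p0 \<noteq> 0"
    "\<And>p. p \<in> fst \<kappa> \<Longrightarrow> dist (snd \<kappa> p0) (snd \<kappa> p) \<ge> r \<Longrightarrow> W p = 0"
proof -
  let ?x0 = "snd \<kappa> p0"
  obtain e :: 'e where e: "e \<in> Basis" using nonempty_Basis by blast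
  obtain \<psi> :: "'e \<Rightarrow> real" where \<psi>: "smooth_on UNIV \<psi>" "\<psi> ?x0 > 0" "\<And>x. dist ?x0 x \<ge> r \<Longrightarrow> \<psi> x = 0"
    using bump_function_exists[OF r(1), of ?x0] by blast
  have "continuous_on (cball ?x0 r) (\<lambda>x. (\<psi> x)\<^sup>2 * gmet \<kappa> x e e)"
    by (intro continuous_intros continuous_on_subset[OF smooth_on_imp_continuous_on[OF \<psi>(1)]]
        continuous_on_subset[OF smooth_on_imp_continuous_on[OF smooth_gmet[OF \<kappa>(1)]] r(2)]) auto
  then have "bounded ((\<lambda>x. (\<psi> x)\<^sup>2 * gmet \<kappa> x e e) ` cball ?x0 r)"
    by (intro compact_imp_bounded compact_continuous_image) auto
  then obtain B where B_pos: "B > 0"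
    and B_norm: "\<And>x. x \<in> cball ?x0 r \<Longrightarrow> norm ((\<psi> x)\<^sup>2 * gmet \<kappa> x e e) \<le> B"
    unfolding bounded_pos by blast
  have B: "B > 0" "\<And>x. x \<in> cball ?x0 r \<Longrightarrow> (\<psi> x)\<^sup>2 * gmet \<kappa> x e e \<le> B"
    using B_pos order_trans[OF abs_ge_self B_norm[unfolded real_norm_def]] .
  \<comment> \<open>B bounds the squared length of the unscaled field on the ball, and B < (B +
    1)^2.\<close>
  define \<epsilon> where "\<epsilon> = 1 / (B + 1)"
  have \<epsilon>: "\<epsilon> > 0" "\<epsilon>\<^sup>2 * B < 1"
  proof -
    show "\<epsilon> > 0" using B(1) by (simp add: \<epsilon>_def)
    have "B < (B + 1)\<^sup>2" using B(1) by (simp add: power2_eq_square algebra_simps add_pos_pos)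
    then show "\<epsilon>\<^sup>2 * B < 1" using B(1) by (simp add: \<epsilon>_def power_divide field_simps)
  qed
  define W where "W p = (if p \<in> fst \<kappa> then coord_vec A \<kappa> p ((\<epsilon> * \<psi> (snd \<kappa> p)) *\<^sub>R e) else 0)" for p
  have W0: "W p = 0" if "p \<in> fst \<kappa> \<Longrightarrow> dist ?x0 (snd \<kappa> p) \<ge> r" for p
    using that \<psi>(3)[of "snd \<kappa> p"] coord_vec_eq_0_iff[OF \<kappa>(1), of p 0] by (simp add: W_def)
  \<comment> \<open>Closedness in the whole manifold, and not merely in the chart domain, is what
    makes the complement usable as an open set below.\<close>
  define K where "K = chart_inv \<kappa> ` cball ?x0 r"
  have K: "closed K" "K \<subseteq> fst \<kappa>"
  proof -
    have "compact K"
      unfolding K_def using continuous_on_subset[OF continuous_on_chart_inv[OF \<kappa>(1)] r(2)]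
      by (intro compact_continuous_image) auto
    then show "closed K" by (rule compact_imp_closed)
    show "K \<subseteq> fst \<kappa>"
      unfolding K_def by (intro image_subsetI chart_inv_in subsetD[OF r(2)])
  qed
  have W_out: "W p = 0" if "p \<notin> K" for p
  proof (rule W0)
    assume p: "p \<in> fst \<kappa>"
    then have "snd \<kappa> p \<notin> cball ?x0 r"
      using that chart_inv_left[OF \<kappa>(1) p] unfolding K_def by force
    then show "dist ?x0 (snd \<kappa> p) \<ge> r" by simp
  qed
  have "smooth_vector_field A W"
    unfolding smooth_vector_field_def
  proof (intro conjI allI ballI)
    show "W p \<in> tangent_space A p" for p
      using \<kappa>(1) coord_vec_in_tangent_space tangent_space_closed(1) by (simp add: W_def)
    fix \<mu> assume \<mu>: "\<mu> \<in> A"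
    show "smooth_on (chart_image \<mu>) (\<lambda>x. W (chart_inv \<mu> x) \<mu>)"
    proof (rule smooth_on_locally)
      fix x assume "x \<in> chart_image \<mu>"
      then obtain q where q: "q \<in> fst \<mu>" "x = snd \<mu> q" by blast
      \<comment> \<open>The chart domain and the complement of K are open and cover the manifold. On
        the former the field is an explicit smooth expression transported by the transition map, on
        the latter it vanishes.\<close>
      show "\<exists>T. open T \<and> x \<in> T \<and> smooth_on T (\<lambda>x. W (chart_inv \<mu> x) \<mu>)"
      proof (cases "q \<in> fst \<kappa>")
        case True
        let ?T = "snd \<mu> ` (fst \<mu> \<inter> fst \<kappa>)" and ?S = "snd \<kappa> ` (fst \<kappa> \<inter> fst \<mu>)"
        note T = open_overlap[OF \<mu> \<kappa>(1)] and S = open_overlap[OF \<kappa>(1) \<mu>]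
        have img: "transition \<mu> \<kappa> ` ?T \<subseteq> ?S" using \<mu> by (auto simp: transition_chart)
        have "smooth_on ?T (\<lambda>x. (\<epsilon> * \<psi> (transition \<mu> \<kappa> x)) *\<^sub>R
            frechet_derivative (transition \<kappa> \<mu>) (at (transition \<mu> \<kappa> x)) e)"
          by (intro smooth_on_scaleR bounded_bilinear.smooth_on[OF bounded_bilinear_mult] smooth_on_const T
              smooth_on_compose[OF T open_UNIV subset_UNIV smooth_transition[OF \<mu> \<kappa>(1)] \<psi>(1)]
              smooth_on_compose[OF T S img smooth_transition[OF \<mu> \<kappa>(1)]
                smooth_on_frechet_derivative[OF smooth_transition[OF \<kappa>(1) \<mu>]]])
        moreover have "(\<epsilon> * \<psi> (transition \<mu> \<kappa> x)) *\<^sub>R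
            frechet_derivative (transition \<kappa> \<mu>) (at (transition \<mu> \<kappa> x)) e = W (chart_inv \<mu> x) \<mu>"
          if "x \<in> ?T" for x
        proof -
          obtain q where "q \<in> fst \<mu>" "q \<in> fst \<kappa>" "x = snd \<mu> q" using \<open>x \<in> ?T\<close> by blast
          then show ?thesis
            using \<mu> \<kappa>(1) linear_scale[OF linear_dtrans[of \<kappa> \<mu> q]]
            by (simp add: transition_chart chart_inv_left W_def coord_vec_apply)
        qed
        ultimately have "smooth_on ?T (\<lambda>x. W (chart_inv \<mu> x) \<mu>)"
          by (rule smooth_on_eq[OF T])
        then show ?thesis using T True q by blast
      next
        case False
        let ?T = "snd \<mu> ` (fst \<mu> \<inter> - K)"
        have T: "open ?T" using K(1) \<mu> by (intro open_chart_image_Int) auto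
        have "0 = W (chart_inv \<mu> x) \<mu>" if "x \<in> ?T" for x
          using that \<mu> W_out by (auto simp: chart_inv_left)
        then have "smooth_on ?T (\<lambda>x. W (chart_inv \<mu> x) \<mu>)"
          by (rule smooth_on_eq[OF T smooth_on_const])
        moreover have "x \<in> ?T" using False K(2) q by blast
        ultimately show ?thesis using T by blast
      qed
    qed
  qed
  moreover have "h p (W p) (W p) < 1" for p
  proof (cases "p \<in> K")
    case True
    then have p: "p \<in> fst \<kappa>" using K(2) by blast
    obtain x where x: "x \<in> cball ?x0 r" "p = chart_inv \<kappa> x" using True unfolding K_def by blast
    then have "snd \<kappa> p \<in> cball ?x0 r"
      using chart_inv_right[OF subsetD[OF r(2) x(1)]] by simp
    from B(2)[OF this] have "\<epsilon>\<^sup>2 * ((\<psi> (snd \<kappa> p))\<^sup>2 * gmet \<kappa> (snd \<kappa> p) e e) \<le> \<epsilon>\<^sup>2 * B"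
      by (intro mult_left_mono) auto
    moreover have "h p (W p) (W p) = \<epsilon>\<^sup>2 * ((\<psi> (snd \<kappa> p))\<^sup>2 * gmet \<kappa> (snd \<kappa> p) e e)"
      using p \<kappa>(1) by (simp add: W_def gmet_chart coord_vec_scale h_scale_left h_scale_right
          coord_vec_in_tangent_space tangent_space_closed power2_eq_square)
    ultimately show ?thesis using \<epsilon>(2) by simp
  next
    case False
    then show ?thesis using W_out h_eq_0_iff[of 0 p] tangent_space_closed(1) by simp
  qed
  ultimately have "navigation_data A h W" by (simp add: navigation_data_def metric)
  moreover have "W p0 \<noteq> 0"
    using \<kappa> \<psi>(2) \<epsilon>(1) e nonzero_Basis by (auto simp: W_def coord_vec_eq_0_iff)
  ultimately show thesis using W0 that by blast
qed

lemma piecewise_smooth_curve_segment: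
  assumes \<kappa>: "\<kappa> \<in> A" and seg: "\<And>t. t \<in> {0..1} \<Longrightarrow> x + t *\<^sub>R d \<in> chart_image \<kappa>"
  shows "piecewise_smooth_curve A (\<lambda>t. chart_inv \<kappa> (x + t *\<^sub>R d)) 0 1"
proof -
  let ?l = "\<lambda>t::real. x + t *\<^sub>R d"
  let ?c = "\<lambda>t. chart_inv \<kappa> (?l t)"
  define J where "J = ?l -` chart_image \<kappa>"
  have l: "smooth_on T ?l" if "open T" for T
    by (intro smooth_on_add smooth_on_scaleR smooth_on_const smooth_on_bounded_linear bounded_linear_ident that)
  have J: "open J"
    unfolding J_def using open_chart_image[OF \<kappa>] by (auto intro!: continuous_open_vimage continuous_intros)
  have cont: "continuous_on J ?c"
    by (rule continuous_on_compose2[OF continuous_on_chart_inv[OF \<kappa>] smooth_on_imp_continuous_on[OF l[OF J]]])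
      (auto simp: J_def)
  have "smooth_on (J \<inter> ?c -` fst \<mu>) (snd \<mu> \<circ> ?c)" if \<mu>: "\<mu> \<in> A" for \<mu>
  proof -
    have T: "open (J \<inter> ?c -` fst \<mu>)"
      by (rule continuous_open_preimage[OF cont J open_domain[OF \<mu>]])
    have "?l ` (J \<inter> ?c -` fst \<mu>) \<subseteq> snd \<kappa> ` (fst \<kappa> \<inter> fst \<mu>)"
      using \<kappa> by (auto simp: J_def chart_inv_left)
    from smooth_on_compose[OF T open_overlap[OF \<kappa> \<mu>] this l[OF T] smooth_transition[OF \<kappa> \<mu>]]
    show ?thesis by (simp add: transition_def o_def)
  qed
  then have "smooth_curve_on A J ?c"
    using J cont by (simp add: smooth_curve_on_def)
  moreover have "{0..1} \<subseteq> J" using seg by (auto simp: J_def)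
  ultimately show ?thesis
    unfolding piecewise_smooth_curve_def
    \<comment> \<open>A single piece, with break points \<tau> i = i.\<close>
    by (intro conjI exI[of _ "1::nat"] exI[of _ real]) auto
qed

text \<open>Without wind at the start the norm there is the Riemannian length. Linearity of
  Levi-Civita translation cancels the normalisation, and the length survives only as the coefficient
  of the wind at the end.\<close>

lemma natural_translation_wind_free_start:
  assumes W: "navigation_data A h W" "W (c a) = 0" and c: "piecewise_smooth_curve A c a b"
    and v: "v \<in> tangent_space A (c a)" "v \<noteq> 0"
  shows "natural_translation A h W c a b v =
    levi_civita_translation A h c a b v + sqrt (h (c a) v v) *\<^sub>R W (c b)"
proof -
  have "h (c a) 0 0 = 0" using h_eq_0_iff[of 0] tangent_space_closed(1) by simp
  moreover have "h (c a) v 0 = 0" using h_scale_right[OF v(1) v(1), of 0] by simp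
  ultimately have F: "randers_norm h W (c a) v = sqrt (h (c a) v v)"
    by (simp add: randers_norm_def W(2))
  moreover have "levi_civita_translation A h c a b (r *\<^sub>R v) = r *\<^sub>R levi_civita_translation A h c a b v" for r
    using levi_civita_translation_isometry(3)[OF c v(1) v(1), of r 0] by simp
  ultimately show ?thesis
    using h_pos[OF v] by (simp add: natural_translation_def natural_translation_unit_def W(2) scaleR_add_right)
qed

lemma exists_nonadditive_natural_translation:
  "\<exists>W c a b. navigation_data A h W \<and> piecewise_smooth_curve A c a b \<and>
    (\<exists>u\<in>tangent_space A (c a). \<exists>v\<in>tangent_space A (c a). u \<noteq> 0 \<and> v \<noteq> 0 \<and> u + v \<noteq> 0 \<and>
       natural_translation A h W c a b (u + v)
         \<noteq> natural_translation A h W c a b u + natural_translation A h W c a b v)"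
proof -
  fix p0 :: 'a
  obtain \<kappa> where \<kappa>: "\<kappa> \<in> A" "p0 \<in> fst \<kappa>" by (rule chart_around)
  let ?x0 = "snd \<kappa> p0"
  obtain r where r: "r > 0" "cball ?x0 r \<subseteq> chart_image \<kappa>"
    using open_chart_image[OF \<kappa>(1)] \<kappa>(2) open_contains_cball[of "chart_image \<kappa>"] by blast
  obtain e :: 'e where e: "e \<in> Basis" using nonempty_Basis by blast
  obtain W where W: "navigation_data A h W" "W p0 \<noteq> 0"
    "\<And>p. p \<in> fst \<kappa> \<Longrightarrow> dist ?x0 (snd \<kappa> p) \<ge> r \<Longrightarrow> W p = 0"
    using exists_bump_vector_field[OF \<kappa> r] by blast
  \<comment> \<open>The coordinates of c t are x0 + (1 - t) r e. The curve starts at distance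
    exactly r from the centre, where the bump has already vanished, and ends at p0.\<close>
  define c where "c = (\<lambda>t. chart_inv \<kappa> ((?x0 + r *\<^sub>R e) + t *\<^sub>R (- r *\<^sub>R e)))"
  have in_ball: "(?x0 + r *\<^sub>R e) + t *\<^sub>R (- r *\<^sub>R e) \<in> cball ?x0 r" if "t \<in> {0..1}" for t
  proof -
    have "(?x0 + r *\<^sub>R e) + t *\<^sub>R (- r *\<^sub>R e) = ?x0 + ((1 - t) * r) *\<^sub>R e" by (simp add: algebra_simps)
    moreover have "\<bar>(1 - t) * r\<bar> \<le> r"
      using that r(1) mult_right_mono[of "1 - t" 1 r] by (simp add: abs_mult)
    ultimately show ?thesis using e by (simp add: dist_norm)
  qed
  have c: "piecewise_smooth_curve A c 0 1"
    unfolding c_def using in_ball r(2) by (intro piecewise_smooth_curve_segment \<kappa>) blast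
  have "?x0 + r *\<^sub>R e \<in> chart_image \<kappa>" using in_ball[of 0] r(2) by auto
  then have c0: "c 0 \<in> fst \<kappa>" "snd \<kappa> (c 0) = ?x0 + r *\<^sub>R e"
    by (simp_all add: c_def chart_inv_in chart_inv_right)
  have Wc0: "W (c 0) = 0" using W(3)[OF c0(1)] c0(2) r(1) e by (simp add: dist_norm)
  have c1: "c 1 = p0" using \<kappa> by (simp add: c_def chart_inv_left)
  define u where "u = coord_vec A \<kappa> (c 0) e"
  let ?v = "(- 1 / 2) *\<^sub>R u" and ?P = "levi_civita_translation A h c 0 1"
  have u: "u \<in> tangent_space A (c 0)" "u \<noteq> 0"
    using \<kappa>(1) c0(1) e nonzero_Basis by (auto simp: u_def coord_vec_in_tangent_space coord_vec_eq_0_iff)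
  have ru: "natural_translation A h W c 0 1 (s *\<^sub>R u) = s *\<^sub>R ?P u + (\<bar>s\<bar> * sqrt (h (c 0) u u)) *\<^sub>R W p0"
    if "s \<noteq> 0" for s
  proof -
    have "sqrt (h (c 0) (s *\<^sub>R u) (s *\<^sub>R u)) = \<bar>s\<bar> * sqrt (h (c 0) u u)"
      using u(1) by (simp add: h_scale_left h_scale_right tangent_space_closed real_sqrt_mult
          mult.assoc[symmetric] power2_eq_square[symmetric])
    moreover have "?P (s *\<^sub>R u) = s *\<^sub>R ?P u"
      using levi_civita_translation_isometry(3)[OF c u(1) u(1), of s 0] by simp
    ultimately show ?thesis
      using natural_translation_wind_free_start[OF W(1) Wc0 c, of "s *\<^sub>R u"] u that
      by (simp add: c1 tangent_space_closed)
  qed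
  have sum: "u + ?v = (1 / 2) *\<^sub>R u" using scaleR_left_distrib[of 1 "- 1 / 2" u] by simp
  have "natural_translation A h W c 0 1 (u + ?v)
      \<noteq> natural_translation A h W c 0 1 u + natural_translation A h W c 0 1 ?v"
  proof
    assume eq: "natural_translation A h W c 0 1 (u + ?v)
      = natural_translation A h W c 0 1 u + natural_translation A h W c 0 1 ?v"
    let ?f = "sqrt (h (c 0) u u)"
    \<comment> \<open>The Levi-Civita parts agree on both sides; the coefficients of the wind are
      half the length of u on the left and three halves on the right.\<close>
    have "(1 / 2) *\<^sub>R ?P u + (1 / 2 * ?f) *\<^sub>R W p0
        = (1 *\<^sub>R ?P u + (1 * ?f) *\<^sub>R W p0) + ((- 1 / 2) *\<^sub>R ?P u + (1 / 2 * ?f) *\<^sub>R W p0)"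
      using eq ru[of 1] ru[of "1 / 2"] ru[of "- 1 / 2"] unfolding sum by simp
    also have "\<dots> = (1 + - 1 / 2) *\<^sub>R ?P u + (1 * ?f + 1 / 2 * ?f) *\<^sub>R W p0"
      unfolding scaleR_left_distrib by (simp only: add_ac)
    finally have "?f *\<^sub>R W p0 = 0" by (simp add: scaleR_left_distrib)
    then show False using h_pos[OF u] W(2) by simp
  qed
  moreover have "?v \<in> tangent_space A (c 0)" "?v \<noteq> 0" "u + ?v \<noteq> 0"
    using u sum by (simp_all add: tangent_space_closed del: scaleR_minus_left)
  ultimately show ?thesis using W(1) c u by blast
qed

end

theorem mainTheorem1:
  fixes A :: "('a::{t2_space, second_countable_topology}, 'e::euclidean_space) chart set"
    and h :: "('a, 'e) metric"
    and W :: "'a \<Rightarrow> ('a, 'e) tvec"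
  assumes "smooth_atlas A"
    and "connected (UNIV :: 'a set)"
    and "navigation_data A h W"
  shows "(\<forall>c a b. piecewise_smooth_curve A c a b \<longrightarrow>
            (\<forall>v\<in>tangent_space A (c a). v \<noteq> 0 \<longrightarrow>
               (\<forall>t>0. natural_translation A h W c a b (t *\<^sub>R v)
                        = t *\<^sub>R natural_translation A h W c a b v) \<and>
               randers_norm h W (c b) (natural_translation A h W c a b v)
                 = randers_norm h W (c a) v)) \<and>
         (\<exists>h' W' c a b. navigation_data A h' W' \<and> piecewise_smooth_curve A c a b \<and>
            (\<exists>u\<in>tangent_space A (c a). \<exists>v\<in>tangent_space A (c a).
               u \<noteq> 0 \<and> v \<noteq> 0 \<and> u + v \<noteq> 0 \<and>
               natural_translation A h' W' c a b (u + v)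
                 \<noteq> natural_translation A h' W' c a b u + natural_translation A h' W' c a b v))"
proof -
  interpret riemannian_manifold A h
    using assms by unfold_locales (auto simp: navigation_data_def)
  show ?thesis
    using natural_translation_homogeneous[OF assms(3)] randers_norm_natural_translation[OF assms(3)]
      exists_nonadditive_natural_translation by blast
qed

end
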